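(* Let $N\ge 35$ be a positive integer. Let $G$ be a discrete, torsion-free, non-elementary subgroup of ${\rm Sp}(n,1)$. Let $g$ be a loxodromic element of $G$ with axis $\gamma$ having the form $g={\rm diag}(\lambda_1,\ldots,\lambda_{n-1},\lambda_n,\overline{\lambda}_n^{-1})$, with $\lambda_i\in\mathbb H$, $|\lambda_i|=1$ for $1\le i\le n-1$ and $|\lambda_n|>1$. Let $l=2\log|\lambda_n|$ be the length of the closed geodesic $\gamma/\langle g\rangle$ and suppose that $$R_N=2\sqrt{\left(\cosh\frac{N^nl}{2}+1\right)\left(\cosh\frac{N^nl}{2}-\cos\frac{2\pi}{N}\right)}+2\sqrt{2\left(1-\cos\frac{2\pi}{N}\right)}<\sqrt3-1.$$ Define the positive number $r$ by $$\cosh(2r)=\frac{2(1-R_N)}{R_N^2}.$$ Then the tube $T_r(\gamma)$ is precisely invariant under $\langle g\rangle$ in $G$.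
   Context: Let $\mathbb H$ be the quaternions, $n$ a positive integer, and $\mathbb H^{n,1}$ the right quaternionic vector space of column vectors with $n+1$ quaternionic entries, with the Hermitian form $\langle {\bf z},{\bf w}\rangle=\overline{w}_1z_1+\cdots+\overline{w}_{n-1}z_{n-1}-(\overline{w}_nz_{n+1}+\overline{w}_{n+1}z_n)$. ${\rm Sp}(n,1)$ is the group of linear automorphisms (matrices acting on the left) preserving this form. Let $V_0=\{{\bf z}\ne 0:\langle {\bf z},{\bf z}\rangle=0\}$, $V_-=\{{\bf z}:\langle {\bf z},{\bf z}\rangle<0\}$, and let $\mathbb P$ be the right projection ${\bf z}\mapsto[{\bf z}]$, where ${\bf z}\sim{\bf z}\lambda$ for $\lambda\in\mathbb H\setminus\{0\}$. Quaternionic hyperbolic space is ${\bf H}^n_{\mathbb H}=\mathbb P(V_-)$, with boundary $\partial{\bf H}^n_{\mathbb H}=\mathbb P(V_0)$ and Bergman metric $\rho$ given by $\cosh^2\frac{\rho(z,w)}{2}=\frac{\langle{\bf z},{\bf w}\rangle\langle{\bf w},{\bf z}\rangle}{\langle{\bf z},{\bf z}\rangle\langle{\bf w},{\bf w}\rangle}$ for any lifts ${\bf z},{\bf w}$ of $z,w$; ${\rm Sp}(n,1)$ acts by isometries. An element of ${\rm Sp}(n,1)$ is loxodromic if it has exactly two fixed points in ${\bf H}^n_{\mathbb H}\cup\partial{\bf H}^n_{\mathbb H}$, and both lie in $\partial{\bf H}^n_{\mathbb H}$; its axis is the geodesic joining them. A subgroup of ${\rm Sp}(n,1)$ is elementary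 if it has a finite orbit in ${\bf H}^n_{\mathbb H}\cup\partial{\bf H}^n_{\mathbb H}$. For a geodesic $\gamma$ and $r>0$, the tube $T_r(\gamma)$ is the set of points of ${\bf H}^n_{\mathbb H}$ at distance less than $r$ from $\gamma$. If $\gamma$ is the axis of $g\in G$, then $T_r(\gamma)$ is called precisely invariant under the subgroup $\langle g\rangle$ of $G$ if $h(T_r(\gamma))\cap T_r(\gamma)=\emptyset$ for all $h\in G\setminus\langle g\rangle$.
   Formalization: The formal theorem also assumes that g is primitive in G (not a proper power of an element of G); otherwise, e.g. for g = g0^2 with g0 in G, the element g0 lies outside the subgroup generated by g but maps the tube to itself, so the claim fails. *)

theory Defs
  imports "HOL-Analysis.Analysis" "HOL-Algebra.Generated_Groups"
begin

section \<open>Quaternions\<close>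

datatype quat = Quat (qRe: real) (qI: real) (qJ: real) (qK: real)

lemma quat_eq_iff: "x = y \<longleftrightarrow> qRe x = qRe y \<and> qI x = qI y \<and> qJ x = qJ y \<and> qK x = qK y"
  by (cases x; cases y) simp

instantiation quat :: real_vector
begin

definition "0 = Quat 0 0 0 0"
definition "x + y = Quat (qRe x + qRe y) (qI x + qI y) (qJ x + qJ y) (qK x + qK y)"
definition "- x = Quat (- qRe x) (- qI x) (- qJ x) (- qK x)"
definition "x - y = Quat (qRe x - qRe y) (qI x - qI y) (qJ x - qJ y) (qK x - qK y)"
definition "r *\<^sub>R x = Quat (r * qRe x) (r * qI x) (r * qJ x) (r * qK x)"

instance
  by standard (auto simp: quat_eq_iff zero_quat_def plus_quat_def uminus_quat_def minus_quat_def
    scaleR_quat_def algebra_simps)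

end

instantiation quat :: real_inner
begin

definition "x \<bullet> y = qRe x * qRe y + qI x * qI y + qJ x * qJ y + qK x * qK y"
definition "norm x = sqrt ((qRe x)\<^sup>2 + (qI x)\<^sup>2 + (qJ x)\<^sup>2 + (qK x)\<^sup>2)" for x :: quat
definition "sgn x = x /\<^sub>R norm x" for x :: quat
definition "dist x y = norm (x - y)" for x y :: quat
definition uniformity_quat_def [code del]:
  "(uniformity :: (quat \<times> quat) filter) = (INF e\<in>{0 <..}. principal {(x, y). dist x y < e})"
definition open_quat_def [code del]:
  "open (U :: quat set) \<longleftrightarrow> (\<forall>x\<in>U. eventually (\<lambda>(x', y). x' = x \<longrightarrow> y \<in> U) uniformity)"

instance
proof
  fix x y :: quat
  show "(0 \<le> x \<bullet> x)" by (simp add: inner_quat_def)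
  have *: "x \<bullet> x = (qRe x)\<^sup>2 + (qI x)\<^sup>2 + (qJ x)\<^sup>2 + (qK x)\<^sup>2"
    by (simp add: inner_quat_def power2_eq_square)
  then show "norm x = sqrt (x \<bullet> x)" by (simp add: norm_quat_def)
  show "x \<bullet> x = 0 \<longleftrightarrow> x = 0"
    unfolding * by (auto simp: quat_eq_iff zero_quat_def add_nonneg_eq_0_iff)
qed (auto simp: quat_eq_iff zero_quat_def plus_quat_def uminus_quat_def minus_quat_def
    scaleR_quat_def inner_quat_def sgn_quat_def dist_quat_def uniformity_quat_def open_quat_def
    algebra_simps)

end

instantiation quat :: real_normed_div_algebra
begin

definition "1 = Quat 1 0 0 0"
definition "x * y = Quat
  (qRe x * qRe y - qI x * qI y - qJ x * qJ y - qK x * qK y)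
  (qRe x * qI y + qI x * qRe y + qJ x * qK y - qK x * qJ y)
  (qRe x * qJ y - qI x * qK y + qJ x * qRe y + qK x * qI y)
  (qRe x * qK y + qI x * qJ y - qJ x * qI y + qK x * qRe y)"
definition "inverse x = (let d = (norm x)\<^sup>2 in Quat (qRe x / d) (- qI x / d) (- qJ x / d) (- qK x / d))"
  for x :: quat
definition "x div y = x * inverse y" for x y :: quat

instance
proof
  fix x y :: quat
  have n: "(norm x)\<^sup>2 = (qRe x)\<^sup>2 + (qI x)\<^sup>2 + (qJ x)\<^sup>2 + (qK x)\<^sup>2" for x :: quat
    by (simp add: norm_quat_def)
  show "inverse x * x = 1" "x * inverse x = 1" if "x \<noteq> 0"
  proof -
    define d where "d = (norm x)\<^sup>2"
    have "d \<noteq> 0" using that by (simp add: d_def)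
    moreover have "qRe x * qRe x + qI x * qI x + qJ x * qJ x + qK x * qK x = d"
      using n [of x] by (simp add: d_def power2_eq_square)
    ultimately show "inverse x * x = 1" "x * inverse x = 1"
      by (simp_all add: inverse_quat_def Let_def d_def [symmetric] times_quat_def one_quat_def
          field_simps)
  qed
  have "(norm (x * y))\<^sup>2 = (norm x * norm y)\<^sup>2"
    unfolding power_mult_distrib n times_quat_def by (simp, algebra)
  then show "norm (x * y) = norm x * norm y"
    by (simp add: power2_eq_iff_nonneg)
qed (auto simp: quat_eq_iff zero_quat_def plus_quat_def one_quat_def times_quat_def scaleR_quat_def
    inverse_quat_def divide_quat_def algebra_simps)

end

definition qcnj :: "quat \<Rightarrow> quat"
  where "qcnj x = Quat (qRe x) (- qI x) (- qJ x) (- qK x)"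

section \<open>The Hermitian form and the group \<open>Sp(n,1)\<close>\<close>

text \<open>The \<open>n + 1\<close> coordinates are indexed by a finite type \<open>'m\<close> with \<open>CARD('m) = n + 1\<close>. Two distinct
  indices \<open>p\<close> and \<open>q\<close> play the roles of \<open>n\<close> and \<open>n + 1\<close>; the remaining ones are \<open>1, \<dots>, n - 1\<close>
  (none of them if \<open>n = 1\<close>).\<close>

definition hform :: "'m::finite \<Rightarrow> 'm \<Rightarrow> quat ^ 'm \<Rightarrow> quat ^ 'm \<Rightarrow> quat"
  where "hform p q z w =
    (\<Sum>i\<in>UNIV - {p, q}. qcnj (w $ i) * z $ i) - (qcnj (w $ p) * z $ q + qcnj (w $ q) * z $ p)"

lemma hform_self_real: "hform p q z z = of_real (qRe (hform p q z z))"
proof -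
  have "qI (\<Sum>i\<in>A. qcnj (z $ i) * z $ i) = 0 \<and> qJ (\<Sum>i\<in>A. qcnj (z $ i) * z $ i) = 0
      \<and> qK (\<Sum>i\<in>A. qcnj (z $ i) * z $ i) = 0" for A
    by (induction A rule: infinite_finite_induct)
      (auto simp: zero_quat_def plus_quat_def qcnj_def times_quat_def)
  then show ?thesis
    by (simp add: hform_def quat_eq_iff of_real_def scaleR_quat_def one_quat_def minus_quat_def
        plus_quat_def qcnj_def times_quat_def)
qed

definition Sp :: "'m::finite \<Rightarrow> 'm \<Rightarrow> (quat ^ 'm ^ 'm) monoid"
  where "Sp p q =
    \<lparr>carrier = {A. invertible A \<and> (\<forall>z w. hform p q (A *v z) (A *v w) = hform p q z w)},
     mult = (**), one = mat 1\<rparr>"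

lemma group_Sp: "group (Sp p q)"
proof (rule groupI)
  fix A assume A: "A \<in> carrier (Sp p q)"
  then obtain B where B: "A ** B = mat 1" "B ** A = mat 1"
    by (auto simp: Sp_def invertible_def)
  have "hform p q (B *v z) (B *v w) = hform p q z w" for z w
  proof -
    have "hform p q (A *v (B *v z)) (A *v (B *v w)) = hform p q (B *v z) (B *v w)"
      using A by (simp add: Sp_def)
    then show ?thesis by (simp add: matrix_vector_mul_assoc B)
  qed
  with B have "B \<in> carrier (Sp p q)"
    by (auto simp: Sp_def invertible_def)
  with B show "\<exists>B\<in>carrier (Sp p q). B \<otimes>\<^bsub>Sp p q\<^esub> A = \<one>\<^bsub>Sp p q\<^esub>"
    by (auto simp: Sp_def)
next
  fix A B assume "A \<in> carrier (Sp p q)" "B \<in> carrier (Sp p q)"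
  then show "A \<otimes>\<^bsub>Sp p q\<^esub> B \<in> carrier (Sp p q)"
    by (auto simp: Sp_def matrix_vector_mul_assoc [symmetric] invertible_mult)
qed (auto simp: Sp_def matrix_mul_assoc invertible_def)

section \<open>Quaternionic hyperbolic space\<close>

definition rscale :: "quat ^ 'm \<Rightarrow> quat \<Rightarrow> quat ^ 'm::finite"
  where "rscale z l = (\<chi> i. z $ i * l)"

text \<open>A point of projective space is represented by the set of all its lifts.\<close>

definition proj :: "quat ^ 'm \<Rightarrow> (quat ^ 'm::finite) set"
  where "proj z = {rscale z l | l. l \<noteq> 0}"

text \<open>By \<open>hform_self_real\<close>, taking the real part loses nothing in \<open>V_minus\<close>.\<close>

definition V_zero :: "'m::finite \<Rightarrow> 'm \<Rightarrow> (quat ^ 'm) set"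
  where "V_zero p q = {z. z \<noteq> 0 \<and> hform p q z z = 0}"

definition V_minus :: "'m::finite \<Rightarrow> 'm \<Rightarrow> (quat ^ 'm) set"
  where "V_minus p q = {z. qRe (hform p q z z) < 0}"

definition hyp_space :: "'m::finite \<Rightarrow> 'm \<Rightarrow> (quat ^ 'm) set set"
  where "hyp_space p q = proj ` V_minus p q"

definition hyp_boundary :: "'m::finite \<Rightarrow> 'm \<Rightarrow> (quat ^ 'm) set set"
  where "hyp_boundary p q = proj ` V_zero p q"

definition bergman :: "'m::finite \<Rightarrow> 'm \<Rightarrow> (quat ^ 'm) set \<Rightarrow> (quat ^ 'm) set \<Rightarrow> real"
  where "bergman p q x y = (THE d. 0 \<le> d \<and> (\<forall>z\<in>x. \<forall>w\<in>y.
    of_real ((cosh (d / 2))\<^sup>2) =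
      (hform p q z w * hform p q w z) / (hform p q z z * hform p q w w)))"

definition act :: "quat ^ 'm ^ 'm \<Rightarrow> (quat ^ 'm) set \<Rightarrow> (quat ^ 'm::finite) set"
  where "act A x = (*v) A ` x"

section \<open>Geodesics and loxodromic elements\<close>

definition geodesic_line :: "'m::finite \<Rightarrow> 'm \<Rightarrow> (real \<Rightarrow> (quat ^ 'm) set) \<Rightarrow> bool"
  where "geodesic_line p q c \<longleftrightarrow>
    range c \<subseteq> hyp_space p q \<and> (\<forall>s t. bergman p q (c s) (c t) = \<bar>s - t\<bar>)"

text \<open>Convergence in the quotient topology of projective space: the projection is open, so it means
  that some choice of lifts converges to a lift of the limit.\<close>

definition proj_tendsto :: "('a \<Rightarrow> (quat ^ 'm::finite) set) \<Rightarrow> (quat ^ 'm) set \<Rightarrow> 'a filter \<Rightarrow> bool"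
  where "proj_tendsto c x F \<longleftrightarrow> (\<exists>Z. (\<forall>t. Z t \<in> c t) \<and> (\<exists>z\<in>x. (Z \<longlongrightarrow> z) F))"

definition geodesic_joining ::
    "'m::finite \<Rightarrow> 'm \<Rightarrow> (quat ^ 'm) set \<Rightarrow> (quat ^ 'm) set \<Rightarrow> (quat ^ 'm) set set \<Rightarrow> bool"
  where "geodesic_joining p q x y \<gamma> \<longleftrightarrow>
    (\<exists>c. geodesic_line p q c \<and> \<gamma> = range c \<and> proj_tendsto c x at_bot \<and> proj_tendsto c y at_top)"

definition fixed_points :: "'m::finite \<Rightarrow> 'm \<Rightarrow> quat ^ 'm ^ 'm \<Rightarrow> (quat ^ 'm) set set"
  where "fixed_points p q A = {x \<in> hyp_space p q \<union> hyp_boundary p q. act A x = x}"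

definition loxodromic :: "'m::finite \<Rightarrow> 'm \<Rightarrow> quat ^ 'm ^ 'm \<Rightarrow> bool"
  where "loxodromic p q A \<longleftrightarrow> A \<in> carrier (Sp p q)
    \<and> card (fixed_points p q A) = 2 \<and> fixed_points p q A \<subseteq> hyp_boundary p q"

definition is_axis :: "'m::finite \<Rightarrow> 'm \<Rightarrow> quat ^ 'm ^ 'm \<Rightarrow> (quat ^ 'm) set set \<Rightarrow> bool"
  where "is_axis p q A \<gamma> \<longleftrightarrow> loxodromic p q A \<and>
    (\<exists>x y. x \<noteq> y \<and> fixed_points p q A = {x, y} \<and> geodesic_joining p q x y \<gamma>)"

definition elementary :: "'m::finite \<Rightarrow> 'm \<Rightarrow> (quat ^ 'm ^ 'm) set \<Rightarrow> bool"
  where "elementary p q G \<longleftrightarrow>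
    (\<exists>x \<in> hyp_space p q \<union> hyp_boundary p q. finite ((\<lambda>A. act A x) ` G))"

definition torsion_free :: "('a, 'b) monoid_scheme \<Rightarrow> 'a set \<Rightarrow> bool"
  where "torsion_free S G \<longleftrightarrow>
    (\<forall>x\<in>G. \<forall>k::nat. 0 < k \<and> x [^]\<^bsub>S\<^esub> k = \<one>\<^bsub>S\<^esub> \<longrightarrow> x = \<one>\<^bsub>S\<^esub>)"

text \<open>Not a proper power in \<open>G\<close>; for an infinite order element exponents \<open>k > 0\<close> suffice, as \<open>G\<close>
  is closed under inverses.\<close>

definition primitive_in :: "('a, 'b) monoid_scheme \<Rightarrow> 'a set \<Rightarrow> 'a \<Rightarrow> bool"
  where "primitive_in S G g \<longleftrightarrow> (\<forall>h\<in>G. \<forall>k::nat. h [^]\<^bsub>S\<^esub> k = g \<longrightarrow> k = 1)"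

section \<open>Tubes\<close>

definition tube :: "'m::finite \<Rightarrow> 'm \<Rightarrow> real \<Rightarrow> (quat ^ 'm) set set \<Rightarrow> (quat ^ 'm) set set"
  where "tube p q r \<gamma> = {x \<in> hyp_space p q. (INF y\<in>\<gamma>. bergman p q x y) < r}"

definition precisely_invariant ::
    "(quat ^ 'm::finite) set set \<Rightarrow> (quat ^ 'm ^ 'm) set \<Rightarrow> (quat ^ 'm ^ 'm) set \<Rightarrow> bool"
  where "precisely_invariant T H G \<longleftrightarrow> (\<forall>h \<in> G - H. act h ` T \<inter> T = {})"

text \<open>The matrix \<open>diag(lam 1, \<dots>, lam n, inverse (qcnj (lam n)))\<close>; the value \<open>lam q\<close> is not used.\<close>

definition lox_diag :: "'m::finite \<Rightarrow> 'm \<Rightarrow> ('m \<Rightarrow> quat) \<Rightarrow> quat ^ 'm ^ 'm"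
  where "lox_diag p q lam =
    (\<chi> i j. if i = j then (if i = q then inverse (qcnj (lam p)) else lam i) else 0)"

definition R_const :: "nat \<Rightarrow> nat \<Rightarrow> real \<Rightarrow> real"
  where "R_const N n l =
    2 * sqrt ((cosh (real N ^ n * l / 2) + 1) * (cosh (real N ^ n * l / 2) - cos (2 * pi / real N)))
    + 2 * sqrt (2 * (1 - cos (2 * pi / real N)))"

end

theory Submission
  imports Defs
begin

text \<open>Let \<open>a, b, c, d\<close> be the four entries of \<open>h\<close> in the rows and columns \<open>p, q\<close>. If \<open>h\<close> moves the tube to a set
  meeting it, then two points of the axis \<open>\<gamma>\<close> and of \<open>h \<gamma>\<close> have distance less than \<open>2 * r\<close>, which gives
  \<open>\<bar>a d\<bar> + \<bar>b c\<bar> < cosh (2 * r)\<close>. By Dirichlet's simultaneous approximation some power \<open>f\<close> of \<open>g\<close> is so close to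
  the identity that the constant \<open>M\<close> of Jorgensen's inequality for \<open>f\<close> is at most \<open>R_const N n l\<close>. Then the
  iterates \<open>h\<^sub>j\<^sub>+\<^sub>1 = h\<^sub>j f h\<^sub>j\<^sup>-\<^sup>1\<close> would accumulate unless some \<open>h\<^sub>j\<close> fixes an endpoint of \<open>\<gamma>\<close>. In a discrete
  torsion-free group this forces \<open>h\<close> to fix both endpoints, and the stabiliser of the endpoints is infinite
  cyclic, generated by the primitive element \<open>g\<close>.\<close>

section \<open>Quaternions and the Hermitian form\<close>

text \<open>The constants come from a recursion. With \<open>x = sqrt \<bar>b c\<bar>\<close> and
  \<open>y = sqrt \<bar>a d\<bar>\<close> for each iterate, one step gives
  \<open>x' \<le> M * x * y\<close>, and \<open>y \<le> 1 + x\<close> always holds, so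
  \<open>x\<close> is contracted once \<open>M * (1 + x) < 1\<close>. The bound
  \<open>x\<^sup>2 + y\<^sup>2 < 2 * (1 - M) / M\<^sup>2\<close> on \<open>h\<close> yields this
  after one step, which explains the formula for \<open>cosh (2 * r)\<close>; with
  \<open>M = R\<close> its value exceeds 1 when \<open>0 < R < sqrt 3 - 1\<close>, as
  \<open>R\<^sup>2 + 2 * R - 2\<close> is negative there.

  The obstacle is that the recursion controls the products \<open>a d\<close> and
  \<open>b c\<close>, not the matrices. The entries outside the block are bounded by those inside
  because rows and columns through the block are isotropic. The entries \<open>b\<close> and
  \<open>c\<close> may still be large and small with a bounded product; conjugation by powers of
  \<open>g\<close> changes their ratio but not their product, so discreteness is applied to suitable
  conjugates of the iterates rather than to the iterates.\<close>

instantiation quat :: euclidean_space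
begin

definition "Basis = {Quat 1 0 0 0, Quat 0 1 0 0, Quat 0 0 1 0, Quat 0 0 0 1}"

instance
proof
  fix u v :: quat
  assume "u \<in> Basis" "v \<in> Basis"
  then show "u \<bullet> v = (if u = v then 1 else 0)"
    unfolding Basis_quat_def insert_iff empty_iff
    by (elim disjE FalseE) (simp_all add: inner_quat_def)
next
  fix x :: quat
  show "(\<forall>u\<in>Basis. x \<bullet> u = 0) \<longleftrightarrow> x = 0"
    by (cases x) (simp add: Basis_quat_def inner_quat_def zero_quat_def)
qed (simp_all add: Basis_quat_def)

end

lemma quat_sel [simp]:
  "qRe 0 = 0" "qI 0 = 0" "qJ 0 = 0" "qK 0 = 0"
  "qRe 1 = 1" "qI 1 = 0" "qJ 1 = 0" "qK 1 = 0"
  "qRe (x + y) = qRe x + qRe y" "qI (x + y) = qI x + qI y"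
  "qJ (x + y) = qJ x + qJ y" "qK (x + y) = qK x + qK y"
  "qRe (x - y) = qRe x - qRe y" "qI (x - y) = qI x - qI y"
  "qJ (x - y) = qJ x - qJ y" "qK (x - y) = qK x - qK y"
  "qRe (- x) = - qRe x" "qI (- x) = - qI x" "qJ (- x) = - qJ x" "qK (- x) = - qK x"
  "qRe (r *\<^sub>R x) = r * qRe x" "qI (r *\<^sub>R x) = r * qI x"
  "qJ (r *\<^sub>R x) = r * qJ x" "qK (r *\<^sub>R x) = r * qK x"
  "qRe (of_real r) = r" "qI (of_real r) = 0" "qJ (of_real r) = 0" "qK (of_real r) = 0"
  "qRe (qcnj x) = qRe x" "qI (qcnj x) = - qI x" "qJ (qcnj x) = - qJ x" "qK (qcnj x) = - qK x"
  by (simp_all add: zero_quat_def one_quat_def plus_quat_def minus_quat_def uminus_quat_def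
      scaleR_quat_def qcnj_def of_real_def)

lemma quat_mult_sel:
  "qRe (x * y) = qRe x * qRe y - qI x * qI y - qJ x * qJ y - qK x * qK y"
  "qI (x * y) = qRe x * qI y + qI x * qRe y + qJ x * qK y - qK x * qJ y"
  "qJ (x * y) = qRe x * qJ y - qI x * qK y + qJ x * qRe y + qK x * qI y"
  "qK (x * y) = qRe x * qK y + qI x * qJ y - qJ x * qI y + qK x * qRe y"
  by (simp_all add: times_quat_def)

lemma qcnj_simps [simp]:
  "qcnj 0 = 0" "qcnj 1 = 1" "qcnj (x + y) = qcnj x + qcnj y" "qcnj (x - y) = qcnj x - qcnj y"
  "qcnj (- x) = - qcnj x" "qcnj (r *\<^sub>R x) = r *\<^sub>R qcnj x" "qcnj (of_real r) = of_real r"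
  "qcnj (qcnj x) = x" "qcnj (x * y) = qcnj y * qcnj x"
  by (simp_all add: quat_eq_iff quat_mult_sel)

lemma qcnj_sum [simp]: "qcnj (sum f A) = (\<Sum>i\<in>A. qcnj (f i))"
  by (induction A rule: infinite_finite_induct) auto

lemma qRe_sum [simp]: "qRe (sum f A) = (\<Sum>i\<in>A. qRe (f i))"
  by (induction A rule: infinite_finite_induct) auto

lemma norm_quat_sq: "(norm x)\<^sup>2 = (qRe x)\<^sup>2 + (qI x)\<^sup>2 + (qJ x)\<^sup>2 + (qK x)\<^sup>2"
  by (simp add: norm_quat_def)

lemma norm_qcnj [simp]: "norm (qcnj x) = norm x"
  by (simp add: norm_quat_def)

lemma qcnj_eq_0 [simp]: "qcnj x = 0 \<longleftrightarrow> x = 0"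
  by (metis norm_qcnj norm_eq_zero)

lemma qcnj_mult_self [simp]: "qcnj x * x = of_real (norm x) ^ 2" "x * qcnj x = of_real (norm x) ^ 2"
  unfolding of_real_power [symmetric] norm_quat_sq
  by (simp_all add: quat_eq_iff quat_mult_sel power2_eq_square algebra_simps del: of_real_power)

lemma qRe_of_real_power [simp]: "qRe (of_real r ^ k) = r ^ k"
  by (simp flip: of_real_power)

lemma abs_qRe_le_norm: "\<bar>qRe x\<bar> \<le> norm x"
  by (rule abs_le_square_iff [THEN iffD2, of _ "norm x", simplified]) (simp add: norm_quat_sq)

lemma qRe_le_norm: "qRe x \<le> norm x"
  using abs_qRe_le_norm [of x] by simp

lemma eq_of_real_norm_iff: "x = of_real (norm x) \<longleftrightarrow> qRe x = norm x"
proof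
  assume "qRe x = norm x"
  then have "(qRe x)\<^sup>2 = (qRe x)\<^sup>2 + (qI x)\<^sup>2 + (qJ x)\<^sup>2 + (qK x)\<^sup>2"
    using norm_quat_sq [of x] by simp
  then have "(qI x)\<^sup>2 + (qJ x)\<^sup>2 + (qK x)\<^sup>2 = 0" by simp
  then have "qI x = 0" "qJ x = 0" "qK x = 0"
    by (simp_all add: add_nonneg_eq_0_iff)
  with \<open>qRe x = norm x\<close> show "x = of_real (norm x)" by (simp add: quat_eq_iff)
qed (metis quat_sel(25))

lemma of_real_quat_commute: "of_real r * (x :: quat) = x * of_real r"
  by (simp add: quat_eq_iff quat_mult_sel)

lemma norm_add_sq: "(norm (x + y))\<^sup>2 = (norm x)\<^sup>2 + (norm y)\<^sup>2 + 2 * qRe (qcnj x * y)" for x y :: quat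
  unfolding norm_quat_sq by (simp add: quat_mult_sel power2_eq_square algebra_simps)

lemma norm_diff_sq: "(norm (x - y))\<^sup>2 = (norm x)\<^sup>2 + (norm y)\<^sup>2 - 2 * qRe (qcnj x * y)" for x y :: quat
  unfolding norm_quat_sq by (simp add: quat_mult_sel power2_eq_square algebra_simps)

lemma bounded_linear_qcnj: "bounded_linear qcnj"
  by (rule bounded_linear_intro [where K = 1]) auto

lemmas tendsto_qcnj [tendsto_intros] = bounded_linear.tendsto [OF bounded_linear_qcnj]

lemma hform_commute: "hform p q = hform q p"
  by (auto simp: hform_def fun_eq_iff insert_commute)

lemma Sp_commute: "Sp p q = Sp q p"
  by (simp add: Sp_def hform_commute [of p q])

lemma sum_UNIV_split:
  fixes f :: "'m::finite \<Rightarrow> 'a::comm_monoid_add"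
  assumes "p \<noteq> q"
  shows "sum f UNIV = f p + (f q + sum f (UNIV - {p, q}))"
proof -
  have "UNIV = insert p (insert q (UNIV - {p, q}))" by auto
  then have "sum f UNIV = sum f (insert p (insert q (UNIV - {p, q})))" by simp
  with assms show ?thesis by simp
qed

lemma hform_qcnj: "qcnj (hform p q z w) = hform p q w z"
  by (simp add: hform_def add.commute)

lemma hform_simps:
  "hform p q (z + z') w = hform p q z w + hform p q z' w"
  "hform p q z (w + w') = hform p q z w + hform p q z w'"
  "hform p q (z - z') w = hform p q z w - hform p q z' w"
  "hform p q z (w - w') = hform p q z w - hform p q z w'"
  "hform p q (rscale z l) w = hform p q z w * l"
  "hform p q z (rscale w l) = qcnj l * hform p q z w"
  by (simp_all add: hform_def rscale_def algebra_simps sum.distrib sum_subtractf sum_distrib_left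
      sum_distrib_right)

lemma norm_hform_commute: "norm (hform p q z w) = norm (hform p q w z)"
  by (metis hform_qcnj norm_qcnj)

definition hnorm :: "'m::finite \<Rightarrow> 'm \<Rightarrow> quat ^ 'm \<Rightarrow> real"
  where "hnorm p q z = qRe (hform p q z z)"

lemma hform_self: "hform p q z z = of_real (hnorm p q z)"
  unfolding hnorm_def by (rule hform_self_real)

lemma hnorm_eq:
  "hnorm p q z = (\<Sum>i\<in>UNIV - {p, q}. (norm (z $ i))\<^sup>2) - 2 * qRe (qcnj (z $ p) * z $ q)"
  by (simp add: hnorm_def hform_def) (simp add: quat_mult_sel)

lemma hnorm_rscale: "hnorm p q (rscale z l) = hnorm p q z * (norm l)\<^sup>2"
proof -
  have "hform p q (rscale z l) (rscale z l) = qcnj l * (hform p q z z * l)"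
    by (simp only: hform_simps mult.assoc)
  also have "\<dots> = of_real (hnorm p q z) * (qcnj l * l)"
    unfolding hform_self [of p q z] by (simp only: of_real_quat_commute mult.assoc)
  also have "\<dots> = of_real (hnorm p q z * (norm l)\<^sup>2)"
    by simp
  finally show ?thesis by (simp only: hnorm_def quat_sel)
qed

text \<open>Gram-Schmidt step: the component of \<open>z\<close> orthogonal to \<open>x\<close>,
  with the Pythagorean value of the form on it. The form of \<open>x\<close> with itself is real and
  so divides out as a scalar.\<close>

lemma hnorm_diff_proj:
  fixes x z :: "quat ^ 'm::finite"
  assumes "hnorm p q x \<noteq> 0"
  defines "l \<equiv> (1 / hnorm p q x) *\<^sub>R hform p q z x"
  shows "hform p q (z - rscale x l) x = 0"
    and "hnorm p q (z - rscale x l) = hnorm p q z - (norm (hform p q z x))\<^sup>2 / hnorm p q x"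
proof -
  show 0: "hform p q (z - rscale x l) x = 0"
    unfolding hform_simps hform_self using assms(1)
    by (simp add: l_def flip: scaleR_conv_of_real)
  have "hnorm p q (z - rscale x l) = qRe (hform p q (z - rscale x l) z)"
    unfolding hnorm_def hform_simps(4) hform_simps(6) 0 by simp
  also have "\<dots> = hnorm p q z - qRe (hform p q x z * l)"
    by (simp add: hform_simps hnorm_def)
  also have "hform p q x z * l = (1 / hnorm p q x) *\<^sub>R of_real (norm (hform p q z x)) ^ 2"
    unfolding l_def hform_qcnj [of p q z x, symmetric] by simp
  finally show "hnorm p q (z - rscale x l) = hnorm p q z - (norm (hform p q z x))\<^sup>2 / hnorm p q x"
    by simp
qed

section \<open>Elements of the group as matrices\<close>

text \<open>With \<open>sg\<close> this encodes the Gram matrix of the form as a signed permutation,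
  sending the basis vector at \<open>i\<close> to \<open>sg p q i\<close> times the one at
  \<open>sw p q i\<close>.\<close>

definition sw :: "'m \<Rightarrow> 'm \<Rightarrow> 'm \<Rightarrow> 'm"
  where "sw p q i = (if i = p then q else if i = q then p else i)"

definition sg :: "'m \<Rightarrow> 'm \<Rightarrow> 'm \<Rightarrow> real"
  where "sg p q i = (if i = p \<or> i = q then - 1 else 1)"

lemma sw_sw [simp]: "sw p q (sw p q i) = i"
  by (simp add: sw_def)

lemma sw_simps [simp]: "sw p q p = q" "sw p q q = p" "i \<noteq> p \<Longrightarrow> i \<noteq> q \<Longrightarrow> sw p q i = i"
  by (simp_all add: sw_def)

lemma sg_simps [simp]: "sg p q (sw p q i) = sg p q i" "sg p q i * sg p q i = 1" "\<bar>sg p q i\<bar> = 1"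
  "sg p q i * (sg p q i * x) = x"
  by (auto simp: sw_def sg_def)

text \<open>\<open>hadj p q A\<close> is \<open>J A\<^sup>* J\<close>, where \<open>J\<close> is the Gram matrix of the form.\<close>

definition hadj :: "'m::finite \<Rightarrow> 'm \<Rightarrow> quat ^ 'm ^ 'm \<Rightarrow> quat ^ 'm ^ 'm"
  where "hadj p q A = (\<chi> i j. (sg p q i * sg p q j) *\<^sub>R qcnj (A $ sw p q j $ sw p q i))"

lemma norm_hadj [simp]: "norm (hadj p q A $ i $ j) = norm (A $ sw p q j $ sw p q i)"
  by (simp add: hadj_def abs_mult)

lemma hadj_nth: "hadj p q A $ i $ j = (sg p q i * sg p q j) *\<^sub>R qcnj (A $ sw p q j $ sw p q i)"
  by (simp add: hadj_def)

lemma hform_alt: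
  assumes "p \<noteq> q"
  shows "hform p q z w = (\<Sum>i\<in>UNIV. sg p q i *\<^sub>R (qcnj (w $ sw p q i) * z $ i))"
proof -
  have "(\<Sum>i\<in>UNIV - {p, q}. sg p q i *\<^sub>R (qcnj (w $ sw p q i) * z $ i)) =
      (\<Sum>i\<in>UNIV - {p, q}. qcnj (w $ i) * z $ i)"
    by (intro sum.cong) (auto simp: sg_def)
  then show ?thesis
    unfolding hform_def sum_UNIV_split [OF assms] using assms by (simp add: sg_def)
qed

lemma matrix_vector_mult_axis: "(A *v axis j (x :: quat)) $ i = A $ i $ j * x"
  by (simp add: matrix_vector_mult_def axis_def if_distrib [of "\<lambda>z. _ * z"] cong: if_cong)

text \<open>Preservation of the form on pairs of basis vectors says that A* J A = J, and J is its
  own inverse. The second equation compares this left inverse with the right inverse supplied by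
  \<open>invertible\<close>.\<close>

lemma hadj_mult:
  assumes "p \<noteq> q" and A: "A \<in> carrier (Sp p q)"
  shows "hadj p q A ** A = mat 1" "A ** hadj p q A = mat 1"
proof -
  have "(hadj p q A ** A) $ i $ j = mat 1 $ i $ j" for i j
  proof -
    have *: "hform p q (axis j 1) (axis (sw p q i) 1) = (if i = j then of_real (sg p q i) else 0)"
      unfolding hform_alt [OF \<open>p \<noteq> q\<close>]
      by (subst sum.remove [of _ j]) (auto simp: axis_def sw_def sg_def)
    have "(hadj p q A ** A) $ i $ j =
        sg p q i *\<^sub>R hform p q (A *v axis j 1) (A *v axis (sw p q i) 1)"
      unfolding hform_alt [OF \<open>p \<noteq> q\<close>]
      by (simp add: matrix_matrix_mult_def matrix_vector_mult_axis hadj_def scaleR_sum_right)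
    also have "\<dots> = sg p q i *\<^sub>R hform p q (axis j 1) (axis (sw p q i) 1)"
      using A by (simp add: Sp_def)
    also have "\<dots> = mat 1 $ i $ j"
      unfolding * by (auto simp: mat_def scaleR_conv_of_real simp flip: of_real_mult)
    finally show ?thesis .
  qed
  then show 1: "hadj p q A ** A = mat 1"
    by (simp add: vec_eq_iff)
  from A obtain B where B: "A ** B = mat 1"
    by (auto simp: Sp_def invertible_def)
  have "hadj p q A = hadj p q A ** (A ** B)" using B by simp
  also have "\<dots> = B" unfolding matrix_mul_assoc 1 by simp
  finally show "A ** hadj p q A = mat 1" using B by simp
qed

lemma hadj_in_Sp:
  assumes "p \<noteq> q" and A: "A \<in> carrier (Sp p q)"
  shows "hadj p q A \<in> carrier (Sp p q)" "inv\<^bsub>Sp p q\<^esub> A = hadj p q A"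
proof -
  interpret group "Sp p q" by (rule group_Sp)
  have "inv\<^bsub>Sp p q\<^esub> A ** A = mat 1"
    using l_inv [OF A] by (simp add: Sp_def)
  then have "inv\<^bsub>Sp p q\<^esub> A ** (A ** hadj p q A) = hadj p q A"
    by (simp add: matrix_mul_assoc)
  then show *: "inv\<^bsub>Sp p q\<^esub> A = hadj p q A" using hadj_mult [OF assms] by simp
  then show "hadj p q A \<in> carrier (Sp p q)" using A inv_closed by metis
qed

lemma hadj_commute: "hadj p q A = hadj q p A"
  by (simp add: hadj_def sg_def sw_def vec_eq_iff)

text \<open>Row \<open>p\<close> is isotropic: this is the entry \<open>(p, q)\<close> of
  \<open>A ** hadj p q A = mat 1\<close>, and taking real parts merges its two mixed terms.\<close>

lemma Sp_row_sum:
  assumes "p \<noteq> q" and A: "A \<in> carrier (Sp p q)"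
  shows "(\<Sum>k\<in>UNIV - {p, q}. (norm (A $ p $ k))\<^sup>2) = 2 * qRe (A $ p $ p * qcnj (A $ p $ q))"
proof -
  have "(\<Sum>k\<in>UNIV - {p, q}. A $ p $ k * hadj p q A $ k $ q) =
      (\<Sum>k\<in>UNIV - {p, q}. - of_real ((norm (A $ p $ k))\<^sup>2))"
    by (intro sum.cong) (auto simp: hadj_def sg_def)
  moreover have "(A ** hadj p q A) $ p $ q = 0"
    using assms by (simp add: hadj_mult mat_def)
  ultimately have "0 = A $ p $ p * qcnj (A $ p $ q) + (A $ p $ q * qcnj (A $ p $ p) -
      (\<Sum>k\<in>UNIV - {p, q}. of_real ((norm (A $ p $ k))\<^sup>2)))"
    using assms by (simp add: matrix_matrix_mult_def sum_UNIV_split [OF assms(1)] hadj_nth sg_def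
        sum_negf algebra_simps)
  then have "qRe 0 = qRe (A $ p $ p * qcnj (A $ p $ q) + (A $ p $ q * qcnj (A $ p $ p) -
      (\<Sum>k\<in>UNIV - {p, q}. of_real ((norm (A $ p $ k))\<^sup>2))))"
    by (rule arg_cong)
  then show ?thesis by (simp add: quat_mult_sel algebra_simps)
qed

lemma Sp_row_sum_le:
  assumes "p \<noteq> q" and A: "A \<in> carrier (Sp p q)"
  shows "(\<Sum>k\<in>UNIV - {p, q}. (norm (A $ p $ k))\<^sup>2) \<le> 2 * (norm (A $ p $ p) * norm (A $ p $ q))"
  using qRe_le_norm [of "A $ p $ p * qcnj (A $ p $ q)"]
  by (simp add: Sp_row_sum [OF assms] norm_mult)

text \<open>Row \<open>q\<close> of the inverse \<open>hadj p q A\<close> is column \<open>p\<close>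
  of \<open>A\<close> up to order, signs and conjugation, so the row estimate applies.\<close>

lemma Sp_col_sum_le:
  assumes "p \<noteq> q" and A: "A \<in> carrier (Sp p q)"
  shows "(\<Sum>k\<in>UNIV - {p, q}. (norm (A $ k $ p))\<^sup>2) \<le> 2 * (norm (A $ p $ p) * norm (A $ q $ p))"
proof -
  have "(\<Sum>k\<in>UNIV - {p, q}. (norm (hadj p q A $ q $ k))\<^sup>2) \<le>
      2 * (norm (hadj p q A $ q $ q) * norm (hadj p q A $ q $ p))"
    using Sp_row_sum_le [of q p "hadj p q A"] hadj_in_Sp [OF assms] assms(1)
    by (simp add: Sp_commute [of p q] insert_commute del: norm_hadj)
  then show ?thesis by simp
qed

text \<open>Four corner entries control all others, so discreteness arguments need to watch only
  these. Isotropy gives \<open>2 * K\<close> for rows and columns through the block. On any other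
  column the form has value 1, and \<open>1 + 2 * (2 * K) * (2 * K)\<close> is at most
  \<open>(3 * K)\<^sup>2\<close>.\<close>

lemma Sp_entry_bound:
  assumes "p \<noteq> q" and A: "A \<in> carrier (Sp p q)" and "1 \<le> K"
    and K: "\<And>i j. i \<in> {p, q} \<Longrightarrow> j \<in> {p, q} \<Longrightarrow> norm (A $ i $ j) \<le> K"
  shows "norm (A $ i $ j) \<le> 3 * K"
proof -
  have row: "norm (A $ i $ j) \<le> 2 * K" if "i \<in> {p, q}" "j \<notin> {p, q}" for i j
  proof -
    define i' where "i' = sw p q i"
    have i': "i \<noteq> i'" "{p, q} = {i, i'}" "A \<in> carrier (Sp i i')"
      using that A assms(1) by (auto simp: i'_def Sp_commute [of p q] sw_def)
    have "(norm (A $ i $ j))\<^sup>2 \<le> (\<Sum>k\<in>UNIV - {i, i'}. (norm (A $ i $ k))\<^sup>2)"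
      by (rule member_le_sum) (use that i' in auto)
    also have "\<dots> \<le> 2 * (norm (A $ i $ i) * norm (A $ i $ i'))"
      by (rule Sp_row_sum_le [OF i'(1,3)])
    also have "\<dots> \<le> 2 * (K * K)"
      using i'(2) that(1) \<open>1 \<le> K\<close> by (intro mult_left_mono mult_mono K) auto
    also have "\<dots> \<le> (2 * K)\<^sup>2" by (simp add: power2_eq_square)
    finally show ?thesis
      by (rule power2_le_imp_le) (use \<open>1 \<le> K\<close> in simp)
  qed
  have col: "norm (A $ i $ j) \<le> 2 * K" if "i \<notin> {p, q}" "j \<in> {p, q}" for i j
  proof -
    define j' where "j' = sw p q j"
    have j': "j \<noteq> j'" "{p, q} = {j, j'}" "A \<in> carrier (Sp j j')"
      using that A assms(1) by (auto simp: j'_def Sp_commute [of p q] sw_def)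
    have "(norm (A $ i $ j))\<^sup>2 \<le> (\<Sum>k\<in>UNIV - {j, j'}. (norm (A $ k $ j))\<^sup>2)"
      by (rule member_le_sum) (use that j' in auto)
    also have "\<dots> \<le> 2 * (norm (A $ j $ j) * norm (A $ j' $ j))"
      by (rule Sp_col_sum_le [OF j'(1,3)])
    also have "\<dots> \<le> 2 * (K * K)"
      using j'(2) that(2) \<open>1 \<le> K\<close> by (intro mult_left_mono mult_mono K) auto
    also have "\<dots> \<le> (2 * K)\<^sup>2" by (simp add: power2_eq_square)
    finally show ?thesis
      by (rule power2_le_imp_le) (use \<open>1 \<le> K\<close> in simp)
  qed
  have mid: "norm (A $ i $ j) \<le> 3 * K" if "i \<notin> {p, q}" "j \<notin> {p, q}"
  proof -
    have "hnorm p q (axis j 1) = 1"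
    proof -
      have "(\<Sum>i\<in>UNIV - {p, q}. (norm (axis j 1 $ i :: quat))\<^sup>2) =
          (\<Sum>i\<in>UNIV - {p, q}. if i = j then 1 else 0)"
        by (intro sum.cong) (auto simp: axis_def)
      then show ?thesis using that by (auto simp: hnorm_eq axis_def)
    qed
    moreover have "hnorm p q (A *v axis j 1) = hnorm p q (axis j 1)"
      using A by (simp add: Sp_def hnorm_def)
    ultimately have "(\<Sum>k\<in>UNIV - {p, q}. (norm (A $ k $ j))\<^sup>2) =
        1 + 2 * qRe (qcnj (A $ p $ j) * A $ q $ j)"
      by (simp add: hnorm_eq matrix_vector_mult_axis)
    moreover have "(norm (A $ i $ j))\<^sup>2 \<le> (\<Sum>k\<in>UNIV - {p, q}. (norm (A $ k $ j))\<^sup>2)"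
      by (rule member_le_sum) (use that in auto)
    moreover have "qRe (qcnj (A $ p $ j) * A $ q $ j) \<le> norm (A $ p $ j) * norm (A $ q $ j)"
      using qRe_le_norm [of "qcnj (A $ p $ j) * A $ q $ j"] by (simp add: norm_mult)
    moreover have "norm (A $ p $ j) * norm (A $ q $ j) \<le> (2 * K) * (2 * K)"
      using row that \<open>1 \<le> K\<close> by (intro mult_mono) auto
    moreover have "1 \<le> K * K" using \<open>1 \<le> K\<close> mult_mono [of 1 K 1 K] by simp
    ultimately have "(norm (A $ i $ j))\<^sup>2 \<le> (3 * K)\<^sup>2" by (simp add: power2_eq_square)
    then show ?thesis
      by (rule power2_le_imp_le) (use \<open>1 \<le> K\<close> in simp)
  qed
  consider "i \<in> {p, q}" "j \<in> {p, q}" | "i \<in> {p, q}" "j \<notin> {p, q}" | "i \<notin> {p, q}" "j \<in> {p, q}"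
    | "i \<notin> {p, q}" "j \<notin> {p, q}" by blast
  then show ?thesis
  proof cases
    case 1 then show ?thesis using K [of i j] \<open>1 \<le> K\<close> by linarith
  next
    case 2 then show ?thesis using row [of i j] \<open>1 \<le> K\<close> by linarith
  next
    case 3 then show ?thesis using col [of i j] \<open>1 \<le> K\<close> by linarith
  next
    case 4 then show ?thesis by (rule mid)
  qed
qed

section \<open>The Bergman metric\<close>

lemma le_add_of_sq_le:
  fixes t u v :: real
  assumes "t\<^sup>2 \<le> 4 * u * v" "0 \<le> u" "0 \<le> v"
  shows "t \<le> u + v"
proof -
  have "t\<^sup>2 \<le> (u + v)\<^sup>2"
    using assms(1) zero_le_power2 [of "u - v"] by (simp add: power2_eq_square algebra_simps)
  then show ?thesis
    by (rule power2_le_imp_le) (use assms in simp)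
qed

text \<open>The form has one negative direction: \<open>z $ p + z $ q\<close> and
  \<open>z $ p - z $ q\<close> diagonalise it, and only the former counts negatively. For orthogonal
  vectors, Cauchy-Schwarz bounds the product of the negative parts by the product of the positive
  parts, which cannot hold if both vectors are negative.\<close>

lemma hnorm_perp_nonneg:
  fixes x y :: "quat ^ 'm::finite"
  assumes "hnorm p q x < 0" and "hform p q y x = 0"
  shows "0 \<le> hnorm p q y"
proof (rule ccontr)
  assume neg: "\<not> 0 \<le> hnorm p q y"
  define S where "S z = (\<Sum>i\<in>UNIV - {p, q}. (norm (z $ i))\<^sup>2)" for z :: "quat ^ 'm"
  define s where "s z = (norm (z $ p + z $ q))\<^sup>2" for z :: "quat ^ 'm"
  define d where "d z = (norm (z $ p - z $ q))\<^sup>2" for z :: "quat ^ 'm"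
  define Q where "Q = (\<Sum>i\<in>UNIV - {p, q}. qcnj (x $ i) * y $ i)"
  have hnorm: "hnorm p q z = S z + d z / 2 - s z / 2" for z
    unfolding hnorm_eq S_def d_def s_def norm_add_sq norm_diff_sq by (simp add: field_simps)
  have nonneg: "0 \<le> S z" "0 \<le> d z" "0 \<le> s z" for z
    by (simp_all add: S_def d_def s_def sum_nonneg)
  have "Q = qcnj (x $ p) * y $ q + qcnj (x $ q) * y $ p"
    using assms(2) by (simp add: hform_def Q_def)
  then have "2 *\<^sub>R Q = qcnj (x $ p + x $ q) * (y $ p + y $ q) - qcnj (x $ p - x $ q) * (y $ p - y $ q)"
    by (simp add: algebra_simps scaleR_2)
  then have "norm (qcnj (x $ p + x $ q) * (y $ p + y $ q)) =
      norm (2 *\<^sub>R Q + qcnj (x $ p - x $ q) * (y $ p - y $ q))"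
    by simp
  also have "\<dots> \<le> 2 * norm Q + norm (x $ p - x $ q) * norm (y $ p - y $ q)"
    by (rule order_trans [OF norm_triangle_ineq])
      (simp add: norm_mult del: qcnj_simps)
  finally have "norm (x $ p + x $ q) * norm (y $ p + y $ q) \<le>
      2 * norm Q + norm (x $ p - x $ q) * norm (y $ p - y $ q)"
    by (simp add: norm_mult del: qcnj_simps)
  then have "s x * s y \<le> (2 * norm Q + norm (x $ p - x $ q) * norm (y $ p - y $ q))\<^sup>2"
    unfolding s_def power_mult_distrib [symmetric] by (intro power_mono) auto
  also have "\<dots> = 4 * (norm Q)\<^sup>2 + d x * d y +
      2 * (2 * norm Q * (norm (x $ p - x $ q) * norm (y $ p - y $ q)))"
    by (simp add: d_def power2_eq_square algebra_simps)
  also have "\<dots> \<le> 4 * (S x * S y) + d x * d y + 2 * (S x * d y + S y * d x)"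
  proof -
    have "norm Q \<le> (\<Sum>i\<in>UNIV - {p, q}. norm (x $ i) * norm (y $ i))"
      unfolding Q_def by (rule order_trans [OF norm_sum]) (simp add: norm_mult)
    then have "(norm Q)\<^sup>2 \<le> (\<Sum>i\<in>UNIV - {p, q}. norm (x $ i) * norm (y $ i))\<^sup>2"
      by (rule power_mono) simp
    also have "\<dots> \<le> S x * S y"
      unfolding S_def by (rule Cauchy_Schwarz_ineq_sum)
    finally have Q: "(norm Q)\<^sup>2 \<le> S x * S y" .
    have "2 * norm Q * (norm (x $ p - x $ q) * norm (y $ p - y $ q)) \<le> S x * d y + S y * d x"
    proof (rule le_add_of_sq_le)
      have "(2 * norm Q * (norm (x $ p - x $ q) * norm (y $ p - y $ q)))\<^sup>2 =
          4 * (norm Q)\<^sup>2 * (d x * d y)"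
        by (simp add: d_def power2_eq_square algebra_simps)
      also have "\<dots> \<le> 4 * (S x * S y) * (d x * d y)"
        using Q nonneg by (intro mult_right_mono) auto
      finally show "(2 * norm Q * (norm (x $ p - x $ q) * norm (y $ p - y $ q)))\<^sup>2 \<le>
          4 * (S x * d y) * (S y * d x)"
        by (simp add: algebra_simps)
    qed (simp_all add: nonneg)
    with Q show ?thesis by simp
  qed
  also have "\<dots> = (2 * S x + d x) * (2 * S y + d y)"
    by (simp add: algebra_simps)
  also have "\<dots> < s x * s y"
    by (rule mult_strict_mono) (use assms(1) neg nonneg [of x] nonneg [of y] in \<open>auto simp: hnorm\<close>)
  finally show False by simp
qed

lemma hnorm_diff_scale:
  fixes u w :: "quat ^ 'm::finite" and p q :: 'm
  defines "h \<equiv> hform p q u w"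
  shows "hnorm p q (u - rscale w (t *\<^sub>R h)) =
    hnorm p q u - 2 * t * (norm h)\<^sup>2 + t\<^sup>2 * (norm h)\<^sup>2 * hnorm p q w"
proof -
  have h': "hform p q w u = qcnj h" by (simp add: h_def hform_qcnj)
  have e: "hform p q (u - rscale w (t *\<^sub>R h)) (u - rscale w (t *\<^sub>R h)) =
      hform p q u u - t *\<^sub>R (qcnj h * h) - t *\<^sub>R (qcnj h * h) +
      (t * t) *\<^sub>R (qcnj h * hform p q w w * h)"
    unfolding hform_simps h' h_def [symmetric] by (simp add: algebra_simps)
  have "qcnj h * hform p q w w * h = hnorm p q w *\<^sub>R (qcnj h * h)"
    unfolding hform_self scaleR_conv_of_real of_real_quat_commute mult.assoc
    by (simp only: of_real_quat_commute)
  then have "qRe (qcnj h * hform p q w w * h) = hnorm p q w * (norm h)\<^sup>2" by simp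
  then show ?thesis
    unfolding hnorm_def [of p q "u - _"] e
    by (simp add: hnorm_def power2_eq_square [of t] del: qcnj_simps)
qed

text \<open>Taking for \<open>l\<close> a real multiple \<open>t\<close> of
  \<open>hform p q u w\<close> gives a real quadratic in \<open>t\<close>. Positivity is assumed on
  the vectors \<open>u - rscale w l\<close> alone, so the sign of \<open>hnorm p q w\<close> has to
  be derived along the way.\<close>

lemma hform_Cauchy_Schwarz:
  fixes u w :: "quat ^ 'm::finite"
  assumes "\<And>l. 0 \<le> hnorm p q (u - rscale w l)"
  shows "(norm (hform p q u w))\<^sup>2 \<le> hnorm p q u * hnorm p q w"
proof -
  define H where "H = (norm (hform p q u w))\<^sup>2"
  have H: "0 \<le> hnorm p q u - 2 * t * H + t\<^sup>2 * H * hnorm p q w" for t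
    using assms [of "t *\<^sub>R hform p q u w"] unfolding hnorm_diff_scale H_def .
  show ?thesis
  proof (cases "H = 0")
    case True
    then have h: "hform p q u w = 0" by (simp add: H_def)
    have "0 \<le> hnorm p q u" using H [of 0] by simp
    moreover have "0 \<le> hnorm p q u + T\<^sup>2 * hnorm p q w" for T
    proof -
      have h': "hform p q w u = 0" using h hform_qcnj [of p q u w] by simp
      have "hform p q (u - rscale w (of_real T)) (u - rscale w (of_real T)) =
          of_real (hnorm p q u) + of_real (T * hnorm p q w * T)"
        unfolding hform_simps h h' hform_self [of p q u] hform_self [of p q w]
        by (simp add: mult.assoc)
      then have "hnorm p q (u - rscale w (of_real T)) = hnorm p q u + T * hnorm p q w * T"
        by (simp only: hnorm_def [of p q "u - _"] quat_sel)
      then show ?thesis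
        using assms [of "of_real T"] by (simp add: power2_eq_square algebra_simps)
    qed
    ultimately have "0 \<le> hnorm p q w"
    proof (cases "hnorm p q w < 0")
      case True
      \<comment> \<open>The square root is chosen to make the right side equal to -1.\<close>
      have "0 \<le> hnorm p q u + (sqrt ((hnorm p q u + 1) / - hnorm p q w))\<^sup>2 * hnorm p q w"
        by fact
      also have "\<dots> = - 1"
        using True \<open>0 \<le> hnorm p q u\<close> by (simp add: field_simps)
      finally show ?thesis by simp
    qed simp
    with \<open>0 \<le> hnorm p q u\<close> True show ?thesis by (simp add: H_def)
  next
    case False
    then have "H > 0" by (simp add: H_def)
    \<comment> \<open>Otherwise the quadratic is linear in \<open>t\<close> and takes the value -1
      at the argument given to \<open>H\<close>.\<close>
    have "hnorm p q w \<noteq> 0"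
      using H [of "(hnorm p q u + 1) / (2 * H)"] \<open>H > 0\<close> by auto
    show ?thesis
    proof (cases "hnorm p q w > 0")
      case True
      \<comment> \<open>\<open>1 / hnorm p q w\<close> is the minimiser of the quadratic.\<close>
      then show ?thesis
        using H [of "1 / hnorm p q w"] by (simp add: H_def power2_eq_square field_simps)
    next
      case False
      then have w: "hnorm p q w < 0" using \<open>hnorm p q w \<noteq> 0\<close> by simp
      define t where "t = (\<bar>hnorm p q u\<bar> + 1) / H"
      have "t > 0" using \<open>H > 0\<close> by (simp add: t_def add_nonneg_pos)
      have "t * H = \<bar>hnorm p q u\<bar> + 1" using \<open>H > 0\<close> by (simp add: t_def)
      moreover have "t\<^sup>2 * H * hnorm p q w \<le> 0"
        using w \<open>H > 0\<close> by (simp add: mult_nonneg_nonpos)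
      ultimately show ?thesis using H [of t] by simp
    qed
  qed
qed

lemma hform_reverse_Cauchy_Schwarz:
  assumes "hnorm p q x < 0"
  shows "hnorm p q z * hnorm p q x \<le> (norm (hform p q z x))\<^sup>2"
proof -
  have "0 \<le> hnorm p q z - (norm (hform p q z x))\<^sup>2 / hnorm p q x"
    using hnorm_diff_proj [of p q x z] hnorm_perp_nonneg [OF assms] assms by fastforce
  with assms show ?thesis by (simp add: field_simps)
qed

text \<open>Here \<open>a\<close> and \<open>b\<close> are half distances, as \<open>bergman\<close>
  enters through \<open>cosh (d / 2)\<close>. Split \<open>u\<close> and \<open>w\<close> along
  \<open>x\<close> and orthogonally to it: the parallel parts contribute
  \<open>cosh a * cosh b\<close>, the orthogonal ones at most \<open>sinh a * sinh b\<close> by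
  Cauchy-Schwarz, and these add up to \<open>cosh (a + b)\<close>.\<close>

lemma hyp_triangle:
  fixes u x w :: "quat ^ 'm::finite"
  assumes neg: "hnorm p q u < 0" "hnorm p q x < 0" "hnorm p q w < 0"
    and a: "norm (hform p q u x) = cosh a * sqrt (hnorm p q u * hnorm p q x)" "0 \<le> a"
    and b: "norm (hform p q w x) = cosh b * sqrt (hnorm p q w * hnorm p q x)" "0 \<le> b"
  shows "norm (hform p q u w) \<le> cosh (a + b) * sqrt (hnorm p q u * hnorm p q w)"
proof -
  define N where "N z = - hnorm p q z" for z
  define l where "l z = (1 / hnorm p q x) *\<^sub>R hform p q z x" for z
  define P where "P z = z - rscale x (l z)" for z
  have N: "N u > 0" "N x > 0" "N w > 0" using neg by (simp_all add: N_def)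
  have perp: "hform p q (P z) x = 0" for z
    using hnorm_diff_proj(1) [of p q x z] neg by (simp add: P_def l_def)
  have hP: "hnorm p q (P z) = N z * (sinh c)\<^sup>2"
    if "norm (hform p q z x) = cosh c * sqrt (hnorm p q z * hnorm p q x)" "hnorm p q z < 0" for z c
  proof -
    have "hnorm p q (P z) = hnorm p q z - (norm (hform p q z x))\<^sup>2 / hnorm p q x"
      using hnorm_diff_proj(2) [of p q x z] neg by (simp add: P_def l_def)
    also have "(norm (hform p q z x))\<^sup>2 = (cosh c)\<^sup>2 * (hnorm p q z * hnorm p q x)"
      using that neg by (simp add: power_mult_distrib mult_nonpos_nonpos)
    finally show ?thesis
      using neg by (simp add: N_def cosh_square_eq) (simp add: algebra_simps)
  qed
  have "hform p q u w = hform p q (P u + rscale x (l u)) w"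
    by (simp add: P_def)
  also have "\<dots> = hform p q (P u) w + hform p q x w * l u"
    by (simp only: hform_simps)
  also have "hform p q (P u) w = hform p q (P u) (P w + rscale x (l w))"
    by (simp add: P_def)
  also have "\<dots> = hform p q (P u) (P w)"
    by (simp add: hform_simps(2,6) perp)
  finally have "norm (hform p q u w) \<le> norm (hform p q (P u) (P w)) + norm (hform p q x w) * norm (l u)"
    by (metis norm_mult norm_triangle_ineq)
  also have "norm (hform p q (P u) (P w)) \<le> sqrt (N u * N w) * (sinh a * sinh b)"
  proof -
    have "(norm (hform p q (P u) (P w)))\<^sup>2 \<le> hnorm p q (P u) * hnorm p q (P w)"
      by (rule hform_Cauchy_Schwarz, rule hnorm_perp_nonneg [OF neg(2)])
        (simp add: hform_simps perp)
    also have "\<dots> = (sqrt (N u * N w) * (sinh a * sinh b))\<^sup>2"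
      using N by (simp add: hP [OF a(1) neg(1)] hP [OF b(1) neg(3)] power_mult_distrib)
    finally show ?thesis
      by (rule power2_le_imp_le) (use N a b in simp)
  qed
  also have "norm (hform p q x w) * norm (l u) = sqrt (N u * N w) * (cosh a * cosh b)"
  proof -
    have "sqrt (N u * N x) * sqrt (N w * N x) = sqrt (N u * N w) * N x"
      using N by (simp add: real_sqrt_mult)
    then show ?thesis
      using N unfolding norm_hform_commute [of p q x w] l_def
      by (simp add: a(1) b(1) N_def [symmetric] neg field_simps) (simp add: N_def)
  qed
  finally show ?thesis by (simp add: cosh_add N_def algebra_simps)
qed

section \<open>Distances computed from lifts\<close>

lemma in_proj: "z \<in> proj z"
  unfolding proj_def by (auto simp: rscale_def intro!: exI [of _ 1])

lemma proj_rscale: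
  assumes "l \<noteq> 0"
  shows "proj (rscale z l) = proj z"
proof -
  have 1: "rscale (rscale z l) m = rscale z (l * m)" for m
    by (simp add: rscale_def mult.assoc)
  have 2: "rscale z m = rscale (rscale z l) (inverse l * m)" for m
    using assms by (simp add: 1 flip: mult.assoc)
  show ?thesis
  proof (intro subset_antisym subsetI)
    fix y assume "y \<in> proj (rscale z l)"
    then obtain m where "y = rscale (rscale z l) m" "m \<noteq> 0" by (auto simp: proj_def)
    then show "y \<in> proj z"
      unfolding proj_def using assms 1 by (metis (mono_tags, lifting) mem_Collect_eq mult_eq_0_iff)
  next
    fix y assume "y \<in> proj z"
    then obtain m where "y = rscale z m" "m \<noteq> 0" by (auto simp: proj_def)
    then have "y = rscale (rscale z l) (inverse l * m)" "inverse l * m \<noteq> 0"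
      using 2 [of m] assms by auto
    then show "y \<in> proj (rscale z l)"
      unfolding proj_def by blast
  qed
qed

text \<open>The description operator in \<open>bergman\<close> is well defined: the quotient has the
  same real value \<open>c\<^sup>2\<close> on all lifts, and \<open>c\<close> is at least 1 by the
  reversed Cauchy-Schwarz inequality, so \<open>2 * arcosh c\<close> is the unique solution.\<close>

lemma bergman_proj:
  assumes z: "hnorm p q z < 0" and w: "hnorm p q w < 0"
  shows "0 \<le> bergman p q (proj z) (proj w)"
    and "norm (hform p q z w) =
      cosh (bergman p q (proj z) (proj w) / 2) * sqrt (hnorm p q z * hnorm p q w)"
proof -
  define c where "c = norm (hform p q z w) / sqrt (hnorm p q z * hnorm p q w)"
  have pos: "0 < hnorm p q z * hnorm p q w" using z w by (simp add: mult_neg_neg)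
  have "sqrt (hnorm p q z * hnorm p q w) \<le> norm (hform p q z w)"
    by (rule real_le_lsqrt [THEN order_trans])
      (use hform_reverse_Cauchy_Schwarz [OF w, of z] pos in auto)
  then have "1 \<le> c" using pos by (simp add: c_def)
  have c2: "c\<^sup>2 = (norm (hform p q z w))\<^sup>2 / (hnorm p q z * hnorm p q w)"
    using pos by (simp add: c_def power_divide)
  have "hform p q z' w' * hform p q w' z' / (hform p q z' z' * hform p q w' w') = of_real (c\<^sup>2)"
    if "z' \<in> proj z" "w' \<in> proj w" for z' w'
  proof -
    obtain l m where lm: "z' = rscale z l" "w' = rscale w m" "l \<noteq> 0" "m \<noteq> 0"
      using \<open>z' \<in> proj z\<close> \<open>w' \<in> proj w\<close> by (auto simp: proj_def)
    have "hform p q z' w' * hform p q w' z' = of_real ((norm (hform p q z' w'))\<^sup>2)"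
      unfolding hform_qcnj [of p q z' w', symmetric] by simp
    also have "norm (hform p q z' w') = norm m * norm l * norm (hform p q z w)"
      unfolding lm hform_simps by (simp add: norm_mult)
    finally have "hform p q z' w' * hform p q w' z' / (hform p q z' z' * hform p q w' w') =
        of_real ((norm m * norm l * norm (hform p q z w))\<^sup>2 /
          (hnorm p q z * (norm l)\<^sup>2 * (hnorm p q w * (norm m)\<^sup>2)))"
      unfolding hform_self [of p q z'] hform_self [of p q w']
      by (simp only: lm hnorm_rscale of_real_divide of_real_mult)
    also have "(norm m * norm l * norm (hform p q z w))\<^sup>2 /
          (hnorm p q z * (norm l)\<^sup>2 * (hnorm p q w * (norm m)\<^sup>2)) = c\<^sup>2"
      unfolding c2 using lm pos by (simp add: power_mult_distrib field_simps)
    finally show ?thesis .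
  qed
  then have "bergman p q (proj z) (proj w) =
      (THE d. 0 \<le> d \<and> (\<forall>z'\<in>proj z. \<forall>w'\<in>proj w. of_real ((cosh (d / 2))\<^sup>2) = (of_real (c\<^sup>2) :: quat)))"
    unfolding bergman_def by (simp del: of_real_power)
  also have "\<dots> = (THE d. 0 \<le> d \<and> (cosh (d / 2))\<^sup>2 = c\<^sup>2)"
    using in_proj [of z] in_proj [of w] unfolding of_real_eq_iff by metis
  also have "\<dots> = 2 * arcosh c"
  proof (rule the_equality)
    show "0 \<le> 2 * arcosh c \<and> (cosh (2 * arcosh c / 2))\<^sup>2 = c\<^sup>2"
      using \<open>1 \<le> c\<close> by (simp add: arcosh_nonneg_real cosh_arcosh_real)
  next
    fix d assume d: "0 \<le> d \<and> (cosh (d / 2))\<^sup>2 = c\<^sup>2"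
    then have "cosh (d / 2) = c"
      using \<open>1 \<le> c\<close> power2_eq_iff_nonneg [of "cosh (d / 2)" c] by simp
    then have "arcosh c = d / 2"
      using d by (metis arcosh_cosh_real divide_nonneg_pos zero_less_numeral)
    then show "d = 2 * arcosh c" by simp
  qed
  finally have *: "bergman p q (proj z) (proj w) = 2 * arcosh c" .
  show "0 \<le> bergman p q (proj z) (proj w)"
    using \<open>1 \<le> c\<close> by (simp add: * arcosh_nonneg_real)
  show "norm (hform p q z w) =
      cosh (bergman p q (proj z) (proj w) / 2) * sqrt (hnorm p q z * hnorm p q w)"
    using \<open>1 \<le> c\<close> pos z w by (simp add: * cosh_arcosh_real) (simp add: c_def)
qed

section \<open>The axis\<close>

text \<open>For positive \<open>s\<close> these lift the geodesic between the classes of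
  \<open>axis p 1\<close> and \<open>axis q 1\<close>. The lifts are normalised to
  \<open>hnorm\<close> equal to -2, and \<open>2 * ln s\<close> is an arc length parameter.\<close>

definition axis_vec :: "'m::finite \<Rightarrow> 'm \<Rightarrow> real \<Rightarrow> quat ^ 'm"
  where "axis_vec p q s = (\<chi> i. if i = p then of_real s else if i = q then of_real (inverse s) else 0)"

definition dmat :: "('m \<Rightarrow> quat) \<Rightarrow> quat ^ 'm ^ 'm::finite"
  where "dmat \<mu> = (\<chi> i j. if i = j then \<mu> i else 0)"

lemma dmat_vec: "(dmat \<mu> *v z) $ i = \<mu> i * z $ i"
  by (simp add: dmat_def matrix_vector_mult_def if_distrib [of "\<lambda>x. x * _"] cong: if_cong)

lemma dmat_mult_left: "(dmat \<mu> ** A) $ i $ j = \<mu> i * A $ i $ j"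
  by (simp add: dmat_def matrix_matrix_mult_def if_distrib [of "\<lambda>x. x * _"] cong: if_cong)

lemma dmat_mult_right: "(A ** dmat \<mu>) $ i $ j = A $ i $ j * \<mu> j"
  by (simp add: dmat_def matrix_matrix_mult_def if_distrib [of "\<lambda>x. _ * x"] cong: if_cong)

lemma dmat_mult: "dmat \<mu> ** dmat \<nu> = dmat (\<lambda>i. \<mu> i * \<nu> i)"
  by (simp add: vec_eq_iff dmat_mult_left) (simp add: dmat_def)

lemma dmat_one: "dmat (\<lambda>i. 1) = mat 1"
  by (simp add: dmat_def mat_def)

lemma quat_mult_eq_1_commute:
  assumes "x * y = (1 :: quat)"
  shows "y * x = 1"
proof -
  have "y \<noteq> 0" using assms by auto
  then have "x = x * y * inverse y" by (simp add: mult.assoc)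
  with assms \<open>y \<noteq> 0\<close> show ?thesis by simp
qed

lemma of_real_mult_both: "of_real r * x * of_real s = (r * s) *\<^sub>R (x :: quat)"
  by (simp add: quat_eq_iff quat_mult_sel)

lemma mult_of_real_quat: "x * of_real r = r *\<^sub>R (x :: quat)"
  by (simp add: quat_eq_iff quat_mult_sel)

lemma dmat_in_Sp:
  assumes "p \<noteq> q" and \<mu>: "\<And>i. qcnj (\<mu> (sw p q i)) * \<mu> i = 1"
  shows "dmat \<mu> \<in> carrier (Sp p q)"
proof -
  have \<mu>': "\<mu> i * qcnj (\<mu> (sw p q i)) = 1" for i
    using \<mu> [of i] by (rule quat_mult_eq_1_commute)
  have "dmat \<mu> ** dmat (\<lambda>i. qcnj (\<mu> (sw p q i))) = mat 1"
    "dmat (\<lambda>i. qcnj (\<mu> (sw p q i))) ** dmat \<mu> = mat 1"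
    by (simp_all add: dmat_mult \<mu> \<mu>' dmat_one)
  then have "invertible (dmat \<mu>)" by (auto simp: invertible_def)
  moreover have "hform p q (dmat \<mu> *v z) (dmat \<mu> *v w) = hform p q z w" for z w
  proof -
    have "qcnj (w $ sw p q i) * qcnj (\<mu> (sw p q i)) * (\<mu> i * z $ i) =
        qcnj (w $ sw p q i) * z $ i" for i
      using \<mu> [of i] by (metis mult.assoc mult.left_neutral)
    then show ?thesis
      unfolding hform_alt [OF \<open>p \<noteq> q\<close>] by (simp add: dmat_vec)
  qed
  ultimately show ?thesis by (simp add: Sp_def)
qed

lemma hform_axis:
  assumes "p \<noteq> q" and "a \<in> {p, q}"
  shows "norm (hform p q w (axis a x)) = norm x * norm (w $ sw p q a)"
proof -
  have "(\<Sum>i\<in>UNIV - {p, q}. qcnj (axis a x $ i) * w $ i) = 0"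
    by (rule sum.neutral) (use assms in \<open>auto simp: axis_def\<close>)
  then show ?thesis
    using assms by (auto simp: hform_def axis_def norm_mult)
qed

lemma rscale_axis: "rscale (axis a x) l = axis a (x * l)"
  by (simp add: rscale_def axis_def vec_eq_iff)

lemma sum_sq_eq_0_imp:
  fixes z :: "'a \<Rightarrow> 'b::real_normed_vector"
  assumes "finite A" "(\<Sum>i\<in>A. (norm (z i))\<^sup>2) \<le> 0" "i \<in> A"
  shows "z i = 0"
proof -
  have "(norm (z i))\<^sup>2 \<le> (\<Sum>i\<in>A. (norm (z i))\<^sup>2)"
    by (rule member_le_sum) (use assms in auto)
  then have "(norm (z i))\<^sup>2 \<le> 0" using assms by linarith
  then show ?thesis by simp
qed

text \<open>Equality case of \<open>- hnorm p q w \<le> 2 * norm (w $ p) * norm (w $ q)\<close>.\<close>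

lemma axis_vec_of_hnorm:
  fixes w :: "quat ^ 'm::finite"
  assumes "p \<noteq> q" and neg: "hnorm p q w < 0"
    and eq: "2 * (norm (w $ p) * norm (w $ q)) \<le> - hnorm p q w"
  obtains s where "0 < s" "proj w = proj (axis_vec p q s)"
proof -
  define S where "S = (\<Sum>i\<in>UNIV - {p, q}. (norm (w $ i))\<^sup>2)"
  define \<rho> where "\<rho> = norm (w $ p) * norm (w $ q)"
  have n: "norm (qcnj (w $ p) * w $ q) = \<rho>" by (simp add: \<rho>_def norm_mult)
  have h: "hnorm p q w = S - 2 * qRe (qcnj (w $ p) * w $ q)"
    by (simp add: hnorm_eq S_def)
  have "0 \<le> S" by (simp add: S_def sum_nonneg)
  have r: "qRe (qcnj (w $ p) * w $ q) \<le> \<rho>"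
    using qRe_le_norm [of "qcnj (w $ p) * w $ q"] n by simp
  have "S \<le> 0" "qRe (qcnj (w $ p) * w $ q) = \<rho>"
    using eq h r \<open>0 \<le> S\<close> by (simp_all add: \<rho>_def)
  then have real: "qcnj (w $ p) * w $ q = of_real \<rho>"
    using eq_of_real_norm_iff [of "qcnj (w $ p) * w $ q"] n by simp
  have "0 < \<rho>" using neg h \<open>0 \<le> S\<close> \<open>qRe (qcnj (w $ p) * w $ q) = \<rho>\<close> by simp
  then have nz: "w $ p \<noteq> 0" "w $ q \<noteq> 0" by (auto simp: \<rho>_def)
  have zero: "w $ i = 0" if "i \<noteq> p" "i \<noteq> q" for i
    using sum_sq_eq_0_imp [of "UNIV - {p, q}" "\<lambda>i. w $ i" i] \<open>S \<le> 0\<close> that by (simp add: S_def)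
  define s where "s = sqrt (norm (w $ p) / norm (w $ q))"
  have "0 < s" using nz by (simp add: s_def)
  have s2: "s * s = norm (w $ p) / norm (w $ q)"
    using nz by (simp add: s_def)
  have "w = rscale (axis_vec p q s) (s *\<^sub>R w $ q)"
  proof (rule vec_eq_iff [THEN iffD2], rule allI)
    fix i
    have "(norm (w $ p))\<^sup>2 *\<^sub>R w $ q = w $ p * (qcnj (w $ p) * w $ q)"
      unfolding mult.assoc [symmetric] by (simp add: scaleR_conv_of_real)
    also have "\<dots> = \<rho> *\<^sub>R w $ p"
      unfolding real by (simp add: scaleR_conv_of_real of_real_quat_commute)
    finally have "(1 / \<rho>) *\<^sub>R ((norm (w $ p))\<^sup>2 *\<^sub>R w $ q) = w $ p"
      using \<open>0 < \<rho>\<close> by simp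
    then have "w $ p = (s * s) *\<^sub>R w $ q"
      using nz by (simp add: s2 \<rho>_def power2_eq_square)
    then show "w $ i = rscale (axis_vec p q s) (s *\<^sub>R w $ q) $ i"
      using zero [of i] \<open>0 < s\<close> assms(1)
      by (auto simp: rscale_def axis_vec_def simp flip: scaleR_conv_of_real simp del: of_real_inverse)
  qed
  moreover have "s *\<^sub>R w $ q \<noteq> 0" using nz \<open>0 < s\<close> by simp
  ultimately have "proj w = proj (axis_vec p q s)" by (metis proj_rscale)
  with \<open>0 < s\<close> show ?thesis by (rule that)
qed

lemma hyp_space_lift:
  assumes "x \<in> hyp_space p q" "z \<in> x"
  shows "hnorm p q z < 0" "x = proj z"
proof -
  obtain v where v: "hnorm p q v < 0" "x = proj v"
    using assms(1) by (auto simp: hyp_space_def V_minus_def hnorm_def)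
  then obtain l where l: "z = rscale v l" "l \<noteq> 0"
    using assms(2) by (auto simp: proj_def)
  show "hnorm p q z < 0" using v l by (simp add: hnorm_rscale mult_neg_pos)
  show "x = proj z" using v l by (simp add: proj_rscale)
qed

lemma cosh_half_mult: "cosh ((T - \<tau>) / 2) * cosh ((T + \<tau>) / 2) = (cosh T + cosh \<tau>) / 2"
  for T \<tau> :: real
proof -
  have "cosh ((T + \<tau>) / 2 + (T - \<tau>) / 2) + cosh ((T + \<tau>) / 2 - (T - \<tau>) / 2) =
      2 * (cosh ((T - \<tau>) / 2) * cosh ((T + \<tau>) / 2))"
    by (simp only: cosh_add cosh_diff) simp
  moreover have "(T + \<tau>) / 2 + (T - \<tau>) / 2 = T" "(T + \<tau>) / 2 - (T - \<tau>) / 2 = \<tau>"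
    by (simp_all add: field_simps)
  ultimately show ?thesis by simp
qed

lemma sqrt_mult_neg:
  assumes "w < 0"
  shows "sqrt (x * w) * sqrt (y * w) = - w * sqrt (x * y)"
proof -
  have "sqrt (x * w) * sqrt (y * w) = sqrt (w\<^sup>2) * sqrt (x * y)"
    unfolding real_sqrt_mult [symmetric] by (simp only: power2_eq_square ac_simps)
  then show ?thesis using assms by simp
qed

text \<open>Let \<open>w\<close> lie on the geodesic at time \<open>\<tau>\<close>. Comparing its distances to the points at the times \<open>\<plusminus>T\<close> with
  their mutual distance and letting \<open>T\<close> tend to infinity gives the equality case above.\<close>

lemma geodesic_subset_axis:
  fixes p q :: "'m::finite"
  assumes "p \<noteq> q" and geo: "geodesic_line p q c"
    and ab: "a \<in> {p, q}" "b = sw p q a"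
    and at_bot: "proj_tendsto c (proj (axis a 1)) at_bot"
    and at_top: "proj_tendsto c (proj (axis b 1)) at_top"
    and y: "y \<in> range c"
  obtains s where "0 < s" "y = proj (axis_vec p q s)"
proof -
  obtain Z \<beta> where Z: "\<And>t. Z t \<in> c t" "(Z \<longlongrightarrow> axis b \<beta>) at_top" "\<beta> \<noteq> 0"
    using at_top unfolding proj_tendsto_def proj_def by (auto simp: rscale_axis)
  obtain Z' \<alpha> where Z': "\<And>t. Z' t \<in> c t" "(Z' \<longlongrightarrow> axis a \<alpha>) at_bot" "\<alpha> \<noteq> 0"
    using at_bot unfolding proj_tendsto_def proj_def by (auto simp: rscale_axis)
  obtain \<tau> where \<tau>: "y = c \<tau>" using y by auto
  have hyp: "c t \<in> hyp_space p q" for t using geo by (auto simp: geodesic_line_def)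
  note lifts = hyp_space_lift [OF hyp]
  define w where "w = Z \<tau>"
  have w: "w \<in> c \<tau>" by (simp add: w_def Z)
  have dist: "norm (hform p q u v) = cosh ((s - t) / 2) * sqrt (hnorm p q u * hnorm p q v)"
    if "u \<in> c s" "v \<in> c t" for u v s t
  proof -
    have "bergman p q (c s) (c t) = \<bar>s - t\<bar>"
      using geo by (simp add: geodesic_line_def)
    then have "bergman p q (proj u) (proj v) = \<bar>s - t\<bar>"
      using lifts(2) [OF that(1)] lifts(2) [OF that(2)] by simp
    moreover have "cosh (\<bar>s - t\<bar> / 2) = cosh ((s - t) / 2)"
      by (metis abs_divide abs_numeral cosh_real_abs)
    ultimately show ?thesis
      using bergman_proj(2) [OF lifts(1) [OF that(1)] lifts(1) [OF that(2)]] by simp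
  qed
  have w0: "hnorm p q w < 0" by (rule lifts(1) [OF w])
  \<comment> \<open>Multiplying the pairings of \<open>w\<close> with both points and comparing with
    their mutual pairing cancels \<open>hnorm p q (Z T)\<close> and
    \<open>hnorm p q (Z' (- T))\<close>, which tend to 0. Every remaining factor has a
    limit.\<close>
  have eq: "norm (hform p q (Z T) w) * norm (hform p q (Z' (- T)) w) =
      (1 / 2 + cosh \<tau> / 2 * inverse (cosh T)) * (- hnorm p q w) * norm (hform p q (Z T) (Z' (- T)))" for T
  proof -
    have neg: "hnorm p q (Z T) < 0" "hnorm p q (Z' (- T)) < 0"
      using lifts(1) Z(1) Z'(1) by blast+
    have "cosh ((- T - \<tau>) / 2) = cosh ((T + \<tau>) / 2)"
      by (metis cosh_minus minus_add_distrib minus_divide_left uminus_add_conv_diff diff_conv_add_uminus)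
    then have "norm (hform p q (Z T) w) * norm (hform p q (Z' (- T)) w) =
        cosh ((T - \<tau>) / 2) * cosh ((T + \<tau>) / 2) * (sqrt (hnorm p q (Z T) * hnorm p q w) *
        sqrt (hnorm p q (Z' (- T)) * hnorm p q w))"
      by (simp add: dist [OF Z(1) w] dist [OF Z'(1) w])
    also have "sqrt (hnorm p q (Z T) * hnorm p q w) * sqrt (hnorm p q (Z' (- T)) * hnorm p q w) =
        - hnorm p q w * sqrt (hnorm p q (Z T) * hnorm p q (Z' (- T)))"
      using w0 by (rule sqrt_mult_neg)
    also have "sqrt (hnorm p q (Z T) * hnorm p q (Z' (- T))) =
        norm (hform p q (Z T) (Z' (- T))) / cosh T"
      by (simp add: dist [OF Z(1) Z'(1)])
    finally show ?thesis
      unfolding cosh_half_mult by (simp add: field_simps)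
  qed
  have Z'2: "((\<lambda>T. Z' (- T)) \<longlongrightarrow> axis a \<alpha>) at_top"
    using Z'(2) filterlim_uminus_at_bot_at_top by (rule filterlim_compose)
  have "((\<lambda>T. norm (hform p q (Z T) w) * norm (hform p q (Z' (- T)) w)) \<longlongrightarrow>
      norm (hform p q (axis b \<beta>) w) * norm (hform p q (axis a \<alpha>) w)) at_top"
    unfolding hform_def by (intro tendsto_intros Z(2) Z'2)
  moreover have "((\<lambda>T. norm (hform p q (Z T) w) * norm (hform p q (Z' (- T)) w)) \<longlongrightarrow>
      (1 / 2 + cosh \<tau> / 2 * 0) * (- hnorm p q w) * norm (hform p q (axis b \<beta>) (axis a \<alpha>))) at_top"
    unfolding eq unfolding hform_def
    by (intro tendsto_intros Z(2) Z'2 tendsto_inverse_0_at_top cosh_real_at_top)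
  ultimately have "norm (hform p q (axis b \<beta>) w) * norm (hform p q (axis a \<alpha>) w) =
      (1 / 2 + cosh \<tau> / 2 * 0) * (- hnorm p q w) * norm (hform p q (axis b \<beta>) (axis a \<alpha>))"
    by (rule tendsto_unique [OF trivial_limit_at_top_linorder])
  then have "norm \<beta> * norm (w $ a) * (norm \<alpha> * norm (w $ b)) =
      1 / 2 * (- hnorm p q w) * (norm \<alpha> * norm \<beta>)"
    using ab assms(1) unfolding norm_hform_commute [of p q "axis b \<beta>" w]
      norm_hform_commute [of p q "axis a \<alpha>" w]
    by (auto simp: hform_axis)
  then have "norm \<alpha> * norm \<beta> * (2 * (norm (w $ a) * norm (w $ b))) = norm \<alpha> * norm \<beta> * (- hnorm p q w)"
    by (simp add: algebra_simps)
  moreover have "norm \<alpha> * norm \<beta> \<noteq> 0" using Z(3) Z'(3) by simp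
  ultimately have "2 * (norm (w $ a) * norm (w $ b)) = - hnorm p q w"
    by (metis mult_left_cancel)
  then have "2 * (norm (w $ p) * norm (w $ q)) \<le> - hnorm p q w"
    using ab by (auto simp: mult.commute)
  with axis_vec_of_hnorm [OF assms(1) w0] obtain s where "0 < s" "proj w = proj (axis_vec p q s)"
    by blast
  then show ?thesis using that lifts(2) [OF w] \<tau> by simp
qed

section \<open>Matrix entries and distances between axis points\<close>

lemma hnorm_axis_vec:
  assumes "p \<noteq> q" "s \<noteq> 0"
  shows "hnorm p q (axis_vec p q s) = - 2"
proof -
  have "(\<Sum>i\<in>UNIV - {p, q}. (norm (axis_vec p q s $ i))\<^sup>2) = 0"
    by (rule sum.neutral) (auto simp: axis_vec_def)
  then show ?thesis using assms by (simp add: hnorm_eq axis_vec_def flip: of_real_mult)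
qed

lemma hnorm_Sp: "A \<in> carrier (Sp p q) \<Longrightarrow> hnorm p q (A *v z) = hnorm p q z"
  by (simp add: Sp_def hnorm_def)

lemma matrix_vector_axis_vec:
  assumes "p \<noteq> q"
  shows "(A *v axis_vec p q s) $ i = s *\<^sub>R A $ i $ p + inverse s *\<^sub>R A $ i $ q"
proof -
  have "axis_vec p q s = axis p (of_real s) + axis q (of_real (inverse s))"
    using assms by (simp add: vec_eq_iff axis_vec_def axis_def)
  then show ?thesis
    by (simp add: matrix_vector_right_distrib matrix_vector_mult_axis scaleR_conv_of_real
        of_real_quat_commute del: of_real_inverse)
qed

text \<open>In the basis e_p + e_q, e_p - e_q, which diagonalises the form on the block, the entries
  have squared norms \<open>X00 / 4\<close>, \<open>X01 / 4\<close>, \<open>X10 / 4\<close> and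
  \<open>X11 / 4\<close>. Invariance of the form, used three times, compares them with
  \<open>X00\<close>; the parallelogram law leads back to \<open>a\<close>, \<open>b\<close>,
  \<open>c\<close>, \<open>d\<close>.\<close>

lemma Sp_entries_le_base:
  assumes "p \<noteq> q" and A: "A \<in> carrier (Sp p q)"
  shows "norm (A $ p $ p) * norm (A $ q $ q) + norm (A $ p $ q) * norm (A $ q $ p) \<le>
    (norm (A $ p $ p + A $ p $ q + A $ q $ p + A $ q $ q))\<^sup>2 / 2 - 1"
proof -
  define a b c d where "a = A $ p $ p" and "b = A $ p $ q" and "c = A $ q $ p" and "d = A $ q $ q"
  define X00 X01 X10 X11 where "X00 = (norm (a + b + c + d))\<^sup>2" and "X01 = (norm (a - b + c - d))\<^sup>2"
    and "X10 = (norm (a + b - c - d))\<^sup>2" and "X11 = (norm (a - b - c + d))\<^sup>2"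
  have hnorm_le: "- 2 * qRe (qcnj (z $ p) * z $ q) \<le> hnorm p q z" for z
    by (simp add: hnorm_eq sum_nonneg)
  note defs = X00_def X01_def X10_def X11_def norm_quat_sq
  have "4 * qRe (qcnj (a + b) * (c + d)) = X00 - X10"
    unfolding defs by (simp add: quat_mult_sel power2_eq_square algebra_simps)
  moreover have "- 2 * qRe (qcnj (a + b) * (c + d)) \<le> - 2"
    using hnorm_le [of "A *v axis_vec p q 1"] assms
    by (simp add: hnorm_Sp hnorm_axis_vec matrix_vector_axis_vec a_def b_def c_def d_def
        del: qcnj_simps)
  ultimately have 1: "X10 \<le> X00 - 4" by simp
  \<comment> \<open>Invariance under the inverse compares entries along a row instead of a
    column.\<close>
  have "4 * qRe (qcnj (qcnj d + qcnj b) * (qcnj c + qcnj a)) = X00 - X01"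
    unfolding defs by (simp add: quat_mult_sel power2_eq_square algebra_simps)
  moreover have "- 2 * qRe (qcnj (qcnj d + qcnj b) * (qcnj c + qcnj a)) \<le> - 2"
    using hnorm_le [of "hadj p q A *v axis_vec p q 1"] assms hadj_in_Sp(1) [OF assms]
    by (simp add: hnorm_Sp hnorm_axis_vec matrix_vector_axis_vec hadj_nth sg_def
        a_def b_def c_def d_def del: qcnj_simps)
  ultimately have 2: "X01 \<le> X00 - 4" by simp
  have "4 * qRe (qcnj (a - b) * (c - d)) = X01 - X11"
    unfolding defs by (simp add: quat_mult_sel power2_eq_square algebra_simps)
  moreover have "- 2 * qRe (qcnj (a - b) * (c - d)) \<le> 2"
  proof -
    define o' :: "quat ^ 'a" where "o' = axis p 1 - axis q 1"
    have "(\<Sum>i\<in>UNIV - {p, q}. (norm (o' $ i))\<^sup>2) = 0"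
      by (rule sum.neutral) (auto simp: o'_def axis_def)
    then have "hnorm p q o' = 2"
      using assms by (simp add: hnorm_eq) (simp add: o'_def axis_def)
    then show ?thesis
      using hnorm_le [of "A *v o'"] hnorm_Sp [OF A, of o']
      by (simp add: o'_def matrix_vector_mult_diff_distrib matrix_vector_mult_axis
          a_def b_def c_def d_def del: qcnj_simps)
  qed
  ultimately have 3: "X11 \<le> X01 + 4" by simp
  have "4 * ((norm a)\<^sup>2 + (norm b)\<^sup>2 + (norm c)\<^sup>2 + (norm d)\<^sup>2) = X00 + X01 + X10 + X11"
    unfolding defs by (simp add: power2_eq_square algebra_simps)
  also have "\<dots> \<le> 4 * X00 - 8" using 1 2 3 by simp
  finally have "(norm a)\<^sup>2 + (norm b)\<^sup>2 + (norm c)\<^sup>2 + (norm d)\<^sup>2 \<le> X00 - 2" by simp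
  moreover have "2 * (norm a * norm d) \<le> (norm a)\<^sup>2 + (norm d)\<^sup>2"
    "2 * (norm b * norm c) \<le> (norm b)\<^sup>2 + (norm c)\<^sup>2"
    using sum_squares_bound [of "norm a" "norm d"] sum_squares_bound [of "norm b" "norm c"]
    by simp_all
  ultimately show ?thesis
    unfolding X00_def a_def b_def c_def d_def by simp
qed

text \<open>As both axis vectors have \<open>hnorm\<close> equal to -2, the right side is
  \<open>cosh\<close> of the distance between the axis point at \<open>t\<close> and the image of
  the one at \<open>s\<close>. Diagonal translations move both parameters to 1 and preserve the two
  products on the left.\<close>

lemma Sp_entries_le:
  assumes "p \<noteq> q" and A: "A \<in> carrier (Sp p q)" and "0 < s" "0 < t"
  shows "norm (A $ p $ p) * norm (A $ q $ q) + norm (A $ p $ q) * norm (A $ q $ p) \<le>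
    (norm (hform p q (axis_vec p q t) (A *v axis_vec p q s)))\<^sup>2 / 2 - 1"
proof -
  define D where "D s = dmat (\<lambda>i. of_real (if i = p then s else if i = q then inverse s else 1))" for s :: real
  have D: "D s \<in> carrier (Sp p q)" if "s \<noteq> 0" for s
    unfolding D_def by (rule dmat_in_Sp [OF assms(1)])
      (use assms(1) that in \<open>auto simp: sw_def simp flip: of_real_mult\<close>)
  define B where "B = D (inverse t) ** A ** D s"
  interpret group "Sp p q" by (rule group_Sp)
  have B: "B \<in> carrier (Sp p q)"
    using m_closed [OF m_closed [OF D A] D, of "inverse t" s] assms by (simp add: B_def Sp_def)
  have Bij: "B $ i $ j = ((if i = p then inverse t else if i = q then t else 1) *
      (if j = p then s else if j = q then inverse s else 1)) *\<^sub>R A $ i $ j" for i j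
    unfolding B_def D_def dmat_mult_left dmat_mult_right of_real_mult_both by simp
  have ent: "B $ p $ p = (s / t) *\<^sub>R A $ p $ p" "B $ p $ q = (1 / (s * t)) *\<^sub>R A $ p $ q"
    "B $ q $ p = (s * t) *\<^sub>R A $ q $ p" "B $ q $ q = (t / s) *\<^sub>R A $ q $ q"
    unfolding Bij using assms by (simp_all add: divide_inverse)
  have "norm (A $ p $ p) * norm (A $ q $ q) + norm (A $ p $ q) * norm (A $ q $ p) =
      norm (B $ p $ p) * norm (B $ q $ q) + norm (B $ p $ q) * norm (B $ q $ p)"
    using assms by (simp add: ent)
  also have "\<dots> \<le> (norm (B $ p $ p + B $ p $ q + B $ q $ p + B $ q $ q))\<^sup>2 / 2 - 1"
    by (rule Sp_entries_le_base [OF assms(1) B])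
  also have "norm (B $ p $ p + B $ p $ q + B $ q $ p + B $ q $ q) =
      norm (hform p q (axis_vec p q t) (A *v axis_vec p q s))"
  proof -
    have "(\<Sum>i\<in>UNIV - {p, q}. qcnj ((A *v axis_vec p q s) $ i) * axis_vec p q t $ i) = 0"
      by (rule sum.neutral) (auto simp: axis_vec_def)
    then have "hform p q (axis_vec p q t) (A *v axis_vec p q s) =
        - qcnj (inverse t *\<^sub>R (s *\<^sub>R A $ p $ p + inverse s *\<^sub>R A $ p $ q) +
          t *\<^sub>R (s *\<^sub>R A $ q $ p + inverse s *\<^sub>R A $ q $ q))"
      using assms unfolding hform_def
      by (simp add: matrix_vector_axis_vec)
        (simp add: axis_vec_def mult_of_real_quat scaleR_right_distrib del: of_real_inverse)
    moreover have "inverse t *\<^sub>R (s *\<^sub>R A $ p $ p + inverse s *\<^sub>R A $ p $ q) +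
          t *\<^sub>R (s *\<^sub>R A $ q $ p + inverse s *\<^sub>R A $ q $ q) =
        B $ p $ p + B $ p $ q + B $ q $ p + B $ q $ q"
      unfolding ent using assms by (simp add: algebra_simps divide_inverse)
    ultimately show ?thesis by (simp del: qcnj_simps)
  qed
  finally show ?thesis .
qed

section \<open>Discrete groups containing a diagonal loxodromic element\<close>

lemma hadj_hadj [simp]: "hadj p q (hadj p q A) = A"
  by (simp add: hadj_def vec_eq_iff mult.assoc)

lemma tendsto_matrix_mult:
  fixes A B :: "'a \<Rightarrow> quat ^ 'm ^ 'm::finite"
  assumes "(A \<longlongrightarrow> a) F" "(B \<longlongrightarrow> b) F"
  shows "((\<lambda>x. A x ** B x) \<longlongrightarrow> a ** b) F"
  unfolding matrix_matrix_mult_def by (intro tendsto_intros assms)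

lemma tendsto_hadj: "(A \<longlongrightarrow> a) F \<Longrightarrow> ((\<lambda>x. hadj p q (A x)) \<longlongrightarrow> hadj p q a) F"
  unfolding hadj_def by (intro tendsto_intros)

lemma norm_matrix_le:
  fixes A :: "quat ^ 'm ^ 'm::finite"
  assumes "\<And>i j. norm (A $ i $ j) \<le> K"
  shows "norm A \<le> real (CARD('m)) * (real (CARD('m)) * K)"
proof -
  have row: "norm (A $ i) \<le> real (CARD('m)) * K" for i
  proof -
    have "norm (A $ i) \<le> (\<Sum>j\<in>UNIV. norm (A $ i $ j))"
      unfolding norm_vec_def by (rule L2_set_le_sum) simp
    also have "\<dots> \<le> (\<Sum>j\<in>(UNIV :: 'm set). K)" by (intro sum_mono assms)
    finally show ?thesis by simp
  qed
  have "norm A \<le> (\<Sum>i\<in>UNIV. norm (A $ i))"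
    unfolding norm_vec_def [of A] by (rule L2_set_le_sum) simp
  also have "\<dots> \<le> (\<Sum>i\<in>(UNIV :: 'm set). real (CARD('m)) * K)" by (intro sum_mono row)
  finally show ?thesis by simp
qed

lemma ex_power_bracket:
  fixes K x :: real
  assumes "1 < K" "1 \<le> x"
  obtains n where "K ^ n \<le> x" "x < K ^ Suc n"
proof -
  obtain m where m: "x < K ^ m" using real_arch_pow [OF assms(1)] by blast
  define n where "n = (LEAST m. x < K ^ m)"
  have n: "x < K ^ n" unfolding n_def by (rule LeastI) (rule m)
  then obtain k where k: "n = Suc k" using assms(2) by (cases n) auto
  have "\<not> x < K ^ k" using not_less_Least [of k "\<lambda>m. x < K ^ m"] k n_def by auto
  then show ?thesis using that [of k] n k by simp
qed

lemma norm_eq_1_of_mult_eq_1: "x * y = (1 :: quat) \<Longrightarrow> norm x * norm y = 1"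
  by (metis norm_mult norm_one)

text \<open>For invertible \<open>A\<close> and \<open>i\<close> in \<open>{p, q}\<close> this says
  that \<open>A\<close> fixes the boundary point \<open>proj (axis i 1)\<close>.\<close>

definition stab_axis :: "quat ^ 'm ^ 'm::finite \<Rightarrow> 'm \<Rightarrow> bool"
  where "stab_axis A i \<longleftrightarrow> (\<forall>k. k \<noteq> i \<longrightarrow> A $ k $ i = 0)"

lemma stab_axis_mult:
  assumes "stab_axis B i"
  shows "(A ** B) $ k $ i = A $ k $ i * B $ i $ i"
  unfolding matrix_matrix_mult_def
  by (subst vec_lambda_beta, subst vec_lambda_beta, subst sum.remove [of _ i])
    (use assms in \<open>auto simp: stab_axis_def intro!: sum.neutral\<close>)

text \<open>Of the diagonal element only the norms of its entries are recorded. The assumptions are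
  thus stable under passing to its inverse while exchanging \<open>p\<close> and \<open>q\<close>,
  and results at \<open>p\<close> transfer to \<open>q\<close> by \<open>swapped\<close>.\<close>

locale discrete_lox =
  fixes p q :: "'m::finite" and G :: "(quat ^ 'm ^ 'm) set" and \<mu> :: "'m \<Rightarrow> quat"
  assumes pq: "p \<noteq> q"
    and sub: "subgroup G (Sp p q)"
    and disc: "discrete G"
    and dmat_in: "dmat \<mu> \<in> G"
    and norm_p: "1 < norm (\<mu> p)"
    and norm_q: "norm (\<mu> q) = 1 / norm (\<mu> p)"
    and norm_other: "\<And>i. i \<notin> {p, q} \<Longrightarrow> norm (\<mu> i) = 1"
begin

lemma G_Sp: "A \<in> G \<Longrightarrow> A \<in> carrier (Sp p q)"
  using subgroup.subset [OF sub] by blast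

lemma G_mult: "A \<in> G \<Longrightarrow> B \<in> G \<Longrightarrow> A ** B \<in> G"
  using subgroup.m_closed [OF sub, of A B] by (simp add: Sp_def)

lemma G_hadj: "A \<in> G \<Longrightarrow> hadj p q A \<in> G"
  using subgroup.m_inv_closed [OF sub, of A] hadj_in_Sp [OF pq G_Sp, of A] by simp

lemma G_one: "mat 1 \<in> G"
  using subgroup.one_closed [OF sub] by (simp add: Sp_def)

lemmas G_hadj_mult = hadj_mult [OF pq G_Sp]

lemma hadj_dmat: "hadj p q (dmat \<mu>) = dmat (\<lambda>i. qcnj (\<mu> (sw p q i)))"
  by (auto simp: hadj_def dmat_def vec_eq_iff sw_def sg_def)

lemma swapped: "discrete_lox q p G (\<lambda>i. qcnj (\<mu> (sw p q i)))"
proof (rule discrete_lox.intro)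
  show "subgroup G (Sp q p)" using sub by (simp add: Sp_commute)
  show "dmat (\<lambda>i. qcnj (\<mu> (sw p q i))) \<in> G"
    using G_hadj [OF dmat_in] by (simp add: hadj_dmat)
qed (use pq disc norm_p norm_q norm_other in auto)

text \<open>Discreteness is relative to \<open>G\<close>, so a limit of elements need not be known
  to lie in \<open>G\<close>. The quotients of consecutive terms of an injective convergent sequence
  avoid this: they tend to \<open>mat 1\<close>, which lies in \<open>G\<close> and is isolated
  there.\<close>

lemma finite_bounded: "finite {A \<in> G. \<forall>i j. norm (A $ i $ j) \<le> K}" (is "finite ?S")
proof (rule ccontr)
  assume "infinite ?S"
  then obtain f :: "nat \<Rightarrow> quat ^ 'm ^ 'm" where f: "inj f" "range f \<subseteq> ?S"
    using infinite_countable_subset by blast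
  have "bounded (range f)"
    unfolding bounded_iff using f(2) norm_matrix_le by blast
  \<comment> \<open>Compactness is available because \<open>quat\<close> is an instance of
    \<open>euclidean_space\<close>.\<close>
  then obtain l r where r: "strict_mono r" and lim: "(f \<circ> r) \<longlonglongrightarrow> l"
    using bounded_imp_convergent_subsequence [of f] by blast
  define g where "g n = f (r n)" for n
  have g: "g n \<in> G" "g n = g m \<longleftrightarrow> n = m" for n m
    using f r by (auto simp: g_def inj_eq strict_mono_eq)
  have "g = f \<circ> r" by (simp add: g_def fun_eq_iff)
  with lim have lim: "g \<longlonglongrightarrow> l" by simp
  have "(\<lambda>n. hadj p q (g n) ** g n) \<longlonglongrightarrow> hadj p q l ** l"
    by (intro tendsto_matrix_mult tendsto_hadj lim)
  then have "(\<lambda>n. mat 1 :: quat ^ 'm ^ 'm) \<longlonglongrightarrow> hadj p q l ** l"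
    by (simp add: G_hadj_mult g)
  then have "hadj p q l ** l = mat 1"
    by (simp add: LIMSEQ_const_iff)
  moreover have "(\<lambda>n. hadj p q (g n) ** g (Suc n)) \<longlonglongrightarrow> hadj p q l ** l"
    by (intro tendsto_matrix_mult tendsto_hadj lim LIMSEQ_Suc)
  ultimately have lim1: "(\<lambda>n. hadj p q (g n) ** g (Suc n)) \<longlonglongrightarrow> mat 1" by simp
  obtain T where T: "open T" "T \<inter> G = {mat 1}"
    using discreteD [OF disc G_one] by (auto simp: isolated_in_def)
  then have "eventually (\<lambda>n. hadj p q (g n) ** g (Suc n) \<in> T) sequentially"
    using topological_tendstoD [OF lim1, of T] by auto
  then obtain n where "hadj p q (g n) ** g (Suc n) \<in> T"
    using eventually_happens trivial_limit_sequentially by blast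
  then have "hadj p q (g n) ** g (Suc n) = mat 1"
    using T G_mult [OF G_hadj] g by blast
  then have "g n ** (hadj p q (g n) ** g (Suc n)) = g n" by simp
  then have "g (Suc n) = g n"
    by (simp add: matrix_mul_assoc G_hadj_mult g)
  then show False using g by simp
qed

lemma finite_bounded_block:
  assumes "1 \<le> K"
  shows "finite {A \<in> G. \<forall>i\<in>{p, q}. \<forall>j\<in>{p, q}. norm (A $ i $ j) \<le> K}"
proof (rule finite_subset [OF _ finite_bounded [of "3 * K"]])
  show "{A \<in> G. \<forall>i\<in>{p, q}. \<forall>j\<in>{p, q}. norm (A $ i $ j) \<le> K} \<subseteq>
      {A \<in> G. \<forall>i j. norm (A $ i $ j) \<le> 3 * K}"
    using Sp_entry_bound [OF pq G_Sp assms] by blast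
qed

primrec cnj_pow :: "nat \<Rightarrow> quat ^ 'm ^ 'm \<Rightarrow> quat ^ 'm ^ 'm"
  where "cnj_pow 0 A = A" | "cnj_pow (Suc m) A = hadj p q (dmat \<mu>) ** cnj_pow m A ** dmat \<mu>"

lemma cnj_pow_in: "A \<in> G \<Longrightarrow> cnj_pow m A \<in> G"
  by (induction m) (auto intro: G_mult G_hadj dmat_in)

text \<open>In the corner block each conjugation keeps the norms at \<open>(p, p)\<close> and
  \<open>(q, q)\<close>, divides the one at \<open>(p, q)\<close> by
  \<open>(norm (\<mu> p))\<^sup>2\<close> and multiplies the one at \<open>(q, p)\<close> by
  it.\<close>

lemma norm_cnj_pow:
  "norm (cnj_pow m A $ i $ j) = (norm (\<mu> (sw p q i)) * norm (\<mu> j)) ^ m * norm (A $ i $ j)"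
  by (induction m) (simp_all add: hadj_dmat dmat_mult_left dmat_mult_right norm_mult algebra_simps)

lemma norm_pos: "0 < norm (\<mu> i)"
  using norm_p norm_q norm_other [of i] by (cases "i \<in> {p, q}") auto

lemma norm_le_1: "i \<noteq> p \<Longrightarrow> norm (\<mu> i) \<le> 1"
  using norm_p norm_q norm_other [of i] by (cases "i = q") (auto simp: divide_le_eq)

text \<open>The inverse fixes the same boundary point, and its condition on column \<open>p\<close>
  is a condition on row \<open>q\<close> of \<open>A\<close>.\<close>

lemma stab_axis_hadj:
  assumes "A \<in> G" "stab_axis A p"
  shows "stab_axis (hadj p q A) p" "hadj p q A $ p $ p * A $ p $ p = 1"
    "\<And>j. j \<noteq> q \<Longrightarrow> A $ q $ j = 0"
proof -
  have e: "hadj p q A $ k $ p * A $ p $ p = mat 1 $ k $ p" for k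
    using stab_axis_mult [OF assms(2), of "hadj p q A" k] G_hadj_mult(1) [OF assms(1)] by simp
  then show 1: "hadj p q A $ p $ p * A $ p $ p = 1" by (simp add: mat_def)
  show 2: "stab_axis (hadj p q A) p"
    unfolding stab_axis_def
  proof (intro allI impI)
    fix k assume "k \<noteq> p"
    then have "hadj p q A $ k $ p * A $ p $ p = 0" using e [of k] by (simp add: mat_def)
    with 1 show "hadj p q A $ k $ p = 0" by auto
  qed
  fix j assume "j \<noteq> q"
  then have "sw p q j \<noteq> p" using pq by (auto simp: sw_def split: if_splits)
  then have "norm (hadj p q A $ sw p q j $ p) = 0" using 2 by (simp add: stab_axis_def)
  then show "A $ q $ j = 0" by simp
qed

text \<open>If \<open>A\<close> fixes the attracting fixed point of \<open>g\<close>, then the conjugates \<open>g\<^sup>-\<^sup>m A g\<^sup>m\<close> stay bounded,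
  so that by discreteness two of them agree.\<close>

lemma stab_axis_p_imp_q:
  assumes A: "A \<in> G" and st: "stab_axis A p"
  shows "stab_axis A q"
proof -
  define K where "K = Max (range (\<lambda>(i, j). norm (A $ i $ j)))"
  have K: "norm (A $ i $ j) \<le> K" for i j
    unfolding K_def by (rule Max_ge) auto
  have "cnj_pow m A \<in> {B \<in> G. \<forall>i j. norm (B $ i $ j) \<le> K}" for m
  proof -
    have "norm (cnj_pow m A $ i $ j) \<le> norm (A $ i $ j)" for i j
    proof (cases "A $ i $ j = 0")
      case False
      \<comment> \<open>Row \<open>q\<close> and column \<open>p\<close> vanish off the diagonal;
        they contain all entries that conjugation would expand.\<close>
      then have "i = q \<Longrightarrow> j = q" "j = p \<Longrightarrow> i = p"
        using stab_axis_hadj(3) [OF A st] st by (auto simp: stab_axis_def)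
      then have "norm (\<mu> (sw p q i)) * norm (\<mu> j) \<le> 1"
      proof -
        assume ij: "i = q \<Longrightarrow> j = q" "j = p \<Longrightarrow> i = p"
        consider "i = q" "j = q" | "j = p" "i = p" | "i \<noteq> q" "j \<noteq> p" using ij by blast
        then show ?thesis
        proof cases
          case 3
          then have "sw p q i \<noteq> p" using pq by (auto simp: sw_def split: if_splits)
          then show ?thesis using norm_le_1 [of "sw p q i"] norm_le_1 [of j] 3 by (intro mult_le_one) auto
        qed (use norm_p norm_q in auto)
      qed
      then have "(norm (\<mu> (sw p q i)) * norm (\<mu> j)) ^ m \<le> 1" by (intro power_le_one) auto
      then show ?thesis
        unfolding norm_cnj_pow by (rule mult_left_le_one_le [rotated 2]) auto
    qed (simp add: norm_cnj_pow)
    then show ?thesis using cnj_pow_in [OF A] K order_trans by blast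
  qed
  then have "finite (range (\<lambda>m. cnj_pow m A))"
    by (intro finite_subset [OF _ finite_bounded [of K]]) auto
  then have "\<not> inj (\<lambda>m. cnj_pow m A)" using finite_imageD infinite_UNIV_nat by blast
  then obtain m n where mn: "m \<noteq> n" "cnj_pow m A = cnj_pow n A" by (auto simp: inj_def)
  show ?thesis
    unfolding stab_axis_def
  proof (intro allI impI)
    fix i assume "i \<noteq> q"
    \<comment> \<open>Off the diagonal, column \<open>q\<close> is contracted by a factor less than
      1, so two equal conjugates force its entries to vanish.\<close>
    define \<rho> where "\<rho> = norm (\<mu> (sw p q i)) * norm (\<mu> q)"
    have "\<rho> < 1" "0 < \<rho>"
    proof -
      show "0 < \<rho>" using norm_pos by (simp add: \<rho>_def)
      have "norm (\<mu> (sw p q i)) \<le> 1"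
        by (rule norm_le_1) (use \<open>i \<noteq> q\<close> pq in \<open>auto simp: sw_def split: if_splits\<close>)
      moreover have "norm (\<mu> q) < 1" using norm_p norm_q by (simp add: divide_less_eq)
      ultimately show "\<rho> < 1"
        unfolding \<rho>_def using mult_left_le_one_le [of "norm (\<mu> q)" "norm (\<mu> (sw p q i))"] by simp
    qed
    have "\<rho> ^ m * norm (A $ i $ q) = \<rho> ^ n * norm (A $ i $ q)"
      using arg_cong [OF mn(2), of "\<lambda>B. norm (B $ i $ q)"] by (simp add: norm_cnj_pow \<rho>_def)
    moreover have "\<rho> ^ m \<noteq> \<rho> ^ n"
      using mn(1) \<open>\<rho> < 1\<close> \<open>0 < \<rho>\<close> by (simp add: power_inject_exp')
    ultimately show "A $ i $ q = 0" by simp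
  qed
qed

end

lemma (in discrete_lox) stab_axis_iff:
  assumes "A \<in> G"
  shows "stab_axis A q \<longleftrightarrow> stab_axis A p"
proof -
  interpret inv: discrete_lox q p G "\<lambda>i. qcnj (\<mu> (sw p q i))" by (rule swapped)
  show ?thesis using stab_axis_p_imp_q inv.stab_axis_p_imp_q assms by blast
qed

section \<open>The stabiliser of the endpoints in a torsion-free group\<close>

locale torsion_free_lox = discrete_lox +
  assumes tf: "torsion_free (Sp p q) G"
begin

lemma norm_stab_entries:
  assumes "A \<in> G" "stab_axis A p"
  shows "norm (A $ q $ q) * norm (A $ p $ p) = 1" "A $ p $ q = 0" "A $ q $ p = 0"
proof -
  show "norm (A $ q $ q) * norm (A $ p $ p) = 1"
    using norm_eq_1_of_mult_eq_1 [OF stab_axis_hadj(2) [OF assms]] by simp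
  have "stab_axis A q" using assms stab_axis_iff by blast
  then show "A $ p $ q = 0" "A $ q $ p = 0"
    using assms(2) pq by (auto simp: stab_axis_def)
qed

lemma stab_axis_prod:
  assumes "stab_axis A i" "stab_axis B i"
  shows "stab_axis (A ** B) i" "norm ((A ** B) $ i $ i) = norm (A $ i $ i) * norm (B $ i $ i)"
  using assms(1) by (simp_all add: stab_axis_mult [OF assms(2)] norm_mult stab_axis_def)

lemma stab_axis_power:
  assumes A: "A \<in> G" and st: "stab_axis A p"
  shows "A [^]\<^bsub>Sp p q\<^esub> (n :: nat) \<in> G" "stab_axis (A [^]\<^bsub>Sp p q\<^esub> n) p"
    "norm ((A [^]\<^bsub>Sp p q\<^esub> n) $ p $ p) = norm (A $ p $ p) ^ n"
proof -
  interpret group "Sp p q" by (rule group_Sp)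
  have "A [^]\<^bsub>Sp p q\<^esub> n \<in> G \<and> stab_axis (A [^]\<^bsub>Sp p q\<^esub> n) p \<and>
      norm ((A [^]\<^bsub>Sp p q\<^esub> n) $ p $ p) = norm (A $ p $ p) ^ n"
  proof (induction n)
    case 0
    have "\<one>\<^bsub>Sp p q\<^esub> = mat 1" by (simp add: Sp_def)
    then show ?case using G_one by (simp add: stab_axis_def mat_def)
  next
    case (Suc n)
    have "A [^]\<^bsub>Sp p q\<^esub> Suc n = A [^]\<^bsub>Sp p q\<^esub> n ** A"
      by simp (simp add: Sp_def)
    then show ?case
      using Suc A st G_mult stab_axis_prod [of "A [^]\<^bsub>Sp p q\<^esub> n" p A] by simp
  qed
  then show "A [^]\<^bsub>Sp p q\<^esub> n \<in> G" "stab_axis (A [^]\<^bsub>Sp p q\<^esub> n) p"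
    "norm ((A [^]\<^bsub>Sp p q\<^esub> n) $ p $ p) = norm (A $ p $ p) ^ n" by blast+
qed

text \<open>The powers of \<open>A\<close> have a bounded corner block, so discreteness makes two of
  them equal. Then \<open>A\<close> has finite order and is trivial by torsion-freeness.\<close>

lemma stab_axis_norm_1:
  assumes A: "A \<in> G" and st: "stab_axis A p" and 1: "norm (A $ p $ p) = 1"
  shows "A = mat 1"
proof -
  interpret group "Sp p q" by (rule group_Sp)
  have carr: "A \<in> carrier (Sp p q)" by (rule G_Sp [OF A])
  have "A [^]\<^bsub>Sp p q\<^esub> (n :: nat) \<in> {B \<in> G. \<forall>i\<in>{p, q}. \<forall>j\<in>{p, q}. norm (B $ i $ j) \<le> 1}" for n
    using stab_axis_power [OF A st, of n] norm_stab_entries [of "A [^]\<^bsub>Sp p q\<^esub> n"] 1 by auto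
  then have "finite (range (\<lambda>n :: nat. A [^]\<^bsub>Sp p q\<^esub> n))"
    by (intro finite_subset [OF _ finite_bounded_block [of 1]]) auto
  then have "\<not> inj (\<lambda>n :: nat. A [^]\<^bsub>Sp p q\<^esub> n)" using finite_imageD infinite_UNIV_nat by blast
  then obtain m n :: nat where mn: "m < n" "A [^]\<^bsub>Sp p q\<^esub> m = A [^]\<^bsub>Sp p q\<^esub> n"
    unfolding inj_def by (metis linorder_neqE_nat)
  have "A [^]\<^bsub>Sp p q\<^esub> m \<otimes>\<^bsub>Sp p q\<^esub> A [^]\<^bsub>Sp p q\<^esub> (n - m) = A [^]\<^bsub>Sp p q\<^esub> m"
    using mn nat_pow_mult [OF carr, of m "n - m"] by simp
  then have "A [^]\<^bsub>Sp p q\<^esub> (n - m) = \<one>\<^bsub>Sp p q\<^esub>"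
    using carr by (simp add: l_cancel_one)
  then have "A = \<one>\<^bsub>Sp p q\<^esub>"
    using tf A mn(1) unfolding torsion_free_def by (metis zero_less_diff)
  then show ?thesis by (simp add: Sp_def)
qed

text \<open>The square of an element exchanging the endpoints fixes both and has an entry of norm 1
  at \<open>(p, p)\<close>, so it is trivial. Torsion-freeness then makes the element itself
  trivial, yet it moves the endpoints.\<close>

lemma no_swap:
  assumes A: "A \<in> G" and sp: "\<And>i. i \<noteq> q \<Longrightarrow> A $ i $ p = 0" and sq: "\<And>i. i \<noteq> p \<Longrightarrow> A $ i $ q = 0"
  shows False
proof -
  interpret group "Sp p q" by (rule group_Sp)
  have carr: "A \<in> carrier (Sp p q)" by (rule G_Sp [OF A])
  have row: "A $ p $ k = 0" if "k \<noteq> q" for k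
  proof (cases "k = p")
    case True then show ?thesis using sp pq by simp
  next
    case False
    have "(\<Sum>k\<in>UNIV - {p, q}. (norm (A $ p $ k))\<^sup>2) \<le> 0"
      using Sp_row_sum_le [OF pq carr] sp [of p] pq by simp
    then show ?thesis
      using sum_sq_eq_0_imp [of "UNIV - {p, q}" "\<lambda>k. A $ p $ k" k] False that by simp
  qed
  have sum1: "(\<Sum>k\<in>UNIV. A $ p $ k * B k) = A $ p $ q * B q" for B
    by (subst sum.remove [of _ q]) (auto simp: row intro!: sum.neutral)
  have "(A ** hadj p q A) $ p $ p = 1" by (simp add: G_hadj_mult A mat_def)
  then have "A $ p $ q * hadj p q A $ q $ p = 1"
    by (simp add: matrix_matrix_mult_def sum1)
  then have n: "norm (A $ p $ q) * norm (A $ q $ p) = 1"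
    using norm_eq_1_of_mult_eq_1 [of "A $ p $ q" "hadj p q A $ q $ p"] by simp
  have sum2: "(\<Sum>k\<in>UNIV. B k * A $ k $ p) = B q * A $ q $ p" for B
    by (subst sum.remove [of _ q]) (auto simp: sp intro!: sum.neutral)
  have sq2: "(A ** A) $ i $ p = A $ i $ q * A $ q $ p" for i
    by (simp add: matrix_matrix_mult_def sum2)
  have "stab_axis (A ** A) p" using sq by (simp add: stab_axis_def sq2)
  moreover have "norm ((A ** A) $ p $ p) = 1" by (simp add: sq2 norm_mult n)
  ultimately have "A ** A = mat 1" using stab_axis_norm_1 G_mult A by blast
  then have "A [^]\<^bsub>Sp p q\<^esub> (2 :: nat) = \<one>\<^bsub>Sp p q\<^esub>"
    using carr by (simp add: numeral_2_eq_2) (simp add: Sp_def)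
  then have "A = \<one>\<^bsub>Sp p q\<^esub>" using tf A unfolding torsion_free_def by (metis zero_less_numeral)
  then have "A = mat 1" by (simp add: Sp_def)
  then have "A $ p $ p = 1" by (simp add: mat_def)
  then show False using sp [of p] pq by simp
qed

text \<open>The norm \<open>\<phi>\<close> of the entry at \<open>(p, p)\<close> is multiplicative
  on the stabiliser and has trivial kernel by \<open>stab_axis_norm_1\<close>. By discreteness its
  values above 1 have a least element; division with remainder makes the stabiliser cyclic, and
  primitivity identifies the generator with \<open>dmat \<mu>\<close>.\<close>

lemma stab_axis_generate:
  assumes prim: "primitive_in (Sp p q) G (dmat \<mu>)" and h: "h \<in> G" and st: "stab_axis h p"
  shows "h \<in> generate (Sp p q) {dmat \<mu>}"
proof -
  interpret group "Sp p q" by (rule group_Sp)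
  define \<phi> where "\<phi> A = norm (A $ p $ p)" for A :: "quat ^ 'a ^ 'a"
  \<comment> \<open>The upper bound keeps \<open>F\<close> finite and still admits
    \<open>dmat \<mu>\<close>, so a minimum exists.\<close>
  define F where "F = {A \<in> G. stab_axis A p \<and> 1 < \<phi> A \<and> \<phi> A \<le> norm (\<mu> p)}"
  have "finite F"
  proof (rule finite_subset [OF _ finite_bounded_block [of "norm (\<mu> p)"]])
    show "F \<subseteq> {A \<in> G. \<forall>i\<in>{p, q}. \<forall>j\<in>{p, q}. norm (A $ i $ j) \<le> norm (\<mu> p)}"
    proof
      fix A assume "A \<in> F"
      then have A: "A \<in> G" "stab_axis A p" "1 < norm (A $ p $ p)" "norm (A $ p $ p) \<le> norm (\<mu> p)"
        by (auto simp: F_def \<phi>_def)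
      have "norm (A $ q $ q) \<le> norm (A $ q $ q) * norm (A $ p $ p)"
        using A(3) by (simp add: mult_le_cancel_left1)
      then show "A \<in> {A \<in> G. \<forall>i\<in>{p, q}. \<forall>j\<in>{p, q}. norm (A $ i $ j) \<le> norm (\<mu> p)}"
        using A norm_stab_entries [OF A(1,2)] norm_p by auto
    qed
  qed (use norm_p in simp)
  have stg: "stab_axis (dmat \<mu>) p" "\<phi> (dmat \<mu>) = norm (\<mu> p)"
    by (simp_all add: stab_axis_def dmat_def \<phi>_def)
  then have "dmat \<mu> \<in> F" using dmat_in norm_p by (simp add: F_def)
  then obtain h0 where "h0 \<in> F" and min: "\<And>A. A \<in> F \<Longrightarrow> \<phi> h0 \<le> \<phi> A"
    using \<open>finite F\<close> arg_min_if_finite [of F \<phi>] by (metis empty_iff linorder_not_less)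
  then have h0: "h0 \<in> G" "stab_axis h0 p" "1 < \<phi> h0" "\<phi> h0 \<le> norm (\<mu> p)" by (auto simp: F_def)
  have pow: "\<exists>n :: nat. A = h0 [^]\<^bsub>Sp p q\<^esub> n" if A: "A \<in> G" "stab_axis A p" "1 \<le> \<phi> A" for A
  proof -
    obtain n where n: "\<phi> h0 ^ n \<le> \<phi> A" "\<phi> A < \<phi> h0 ^ Suc n"
      using ex_power_bracket [OF h0(3) A(3)] by blast
    define P where "P = h0 [^]\<^bsub>Sp p q\<^esub> n"
    have P: "P \<in> G" "stab_axis P p" "\<phi> P = \<phi> h0 ^ n"
      using stab_axis_power [OF h0(1,2), of n] by (simp_all add: P_def \<phi>_def)
    define B where "B = hadj p q P ** A"
    have B: "B \<in> G" "stab_axis B p"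
      unfolding B_def using G_mult [OF G_hadj [OF P(1)] A(1)]
        stab_axis_prod(1) [OF stab_axis_hadj(1) [OF P(1,2)] A(2)] by blast+
    have "\<phi> B * \<phi> P = \<phi> A"
    proof -
      have "\<phi> B = norm (hadj p q P $ p $ p) * \<phi> A"
        unfolding B_def \<phi>_def using stab_axis_prod(2) stab_axis_hadj(1) P A by blast
      moreover have "norm (hadj p q P $ p $ p) * \<phi> P = 1"
        using norm_eq_1_of_mult_eq_1 [OF stab_axis_hadj(2) [OF P(1,2)]] by (simp add: \<phi>_def)
      ultimately show ?thesis by (simp add: mult.commute mult.left_commute)
    qed
    then have "1 * \<phi> P \<le> \<phi> B * \<phi> P" "\<phi> B * \<phi> P < \<phi> h0 * \<phi> P" using n P(3) by simp_all
    moreover have "0 < \<phi> P" using P(3) h0(3) by simp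
    ultimately have "1 \<le> \<phi> B" "\<phi> B < \<phi> h0"
      using mult_right_le_imp_le mult_right_less_imp_less [of "\<phi> B" "\<phi> P"] by (blast, simp)
    \<comment> \<open>\<open>B\<close> is the remainder of the division; minimality of
      \<open>h0\<close> excludes values strictly between 1 and \<open>\<phi> h0\<close>.\<close>
    then have "\<phi> B = 1" using min [of B] B h0 by (force simp: F_def)
    then have "B = mat 1" using stab_axis_norm_1 B by (simp add: \<phi>_def)
    then have "P ** B = P" by simp
    then have "A = P" by (simp add: B_def matrix_mul_assoc G_hadj_mult P)
    then show ?thesis by (auto simp: P_def)
  qed
  obtain n :: nat where "dmat \<mu> = h0 [^]\<^bsub>Sp p q\<^esub> n" using pow [OF dmat_in stg(1)] stg norm_p by auto
  moreover from this have "n = 1"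
    using prim h0(1) unfolding primitive_in_def by metis
  moreover have "h0 [^]\<^bsub>Sp p q\<^esub> Suc 0 = h0" using G_Sp [OF h0(1)] by simp
  ultimately have "dmat \<mu> = h0" by simp
  have gen: "generate (Sp p q) {dmat \<mu>} = {dmat \<mu> [^]\<^bsub>Sp p q\<^esub> k | k :: int. k \<in> UNIV}"
    by (rule generate_pow) (rule G_Sp [OF dmat_in])
  have big: "A \<in> generate (Sp p q) {dmat \<mu>}" if A: "A \<in> G" "stab_axis A p" "1 \<le> \<phi> A" for A
  proof -
    obtain n :: nat where "A = dmat \<mu> [^]\<^bsub>Sp p q\<^esub> n" 
      using pow [OF A] \<open>dmat \<mu> = h0\<close> by auto
    then have "A = dmat \<mu> [^]\<^bsub>Sp p q\<^esub> int n" by (simp add: int_pow_int)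
    then show ?thesis using gen by blast
  qed
  show ?thesis
  proof (cases "1 \<le> \<phi> h")
    case False
    have "norm (hadj p q h $ p $ p) * \<phi> h = 1"
      using norm_eq_1_of_mult_eq_1 [OF stab_axis_hadj(2) [OF h st]] by (simp add: \<phi>_def)
    then have "1 \<le> \<phi> (hadj p q h)"
    proof -
      have "norm (hadj p q h $ p $ p) * \<phi> h < 1" if "norm (hadj p q h $ p $ p) \<le> 1"
        using mult_left_le_one_le [of "\<phi> h" "norm (hadj p q h $ p $ p)"] that False
        by (simp add: \<phi>_def)
      with \<open>norm (hadj p q h $ p $ p) * \<phi> h = 1\<close> show ?thesis by (fastforce simp: \<phi>_def)
    qed
    then have "hadj p q h \<in> generate (Sp p q) {dmat \<mu>}"
      using big G_hadj [OF h] stab_axis_hadj(1) [OF h st] by blast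
    then have "inv\<^bsub>Sp p q\<^esub> (hadj p q h) \<in> generate (Sp p q) {dmat \<mu>}"
      by (intro generate_m_inv_closed) (use G_Sp [OF dmat_in] in auto)
    then show ?thesis using hadj_in_Sp(2) [OF pq G_Sp [OF G_hadj [OF h]]] by simp
  qed (use big h st in blast)
qed

end

section \<open>Jorgensen's inequality\<close>

lemma norm_sum_mult_le:
  fixes u v :: "'a \<Rightarrow> quat"
  assumes "(\<Sum>i\<in>A. (norm (u i))\<^sup>2) \<le> 2 * s" "(\<Sum>i\<in>A. (norm (v i))\<^sup>2) \<le> 2 * t"
  shows "(\<Sum>i\<in>A. norm (u i) * norm (v i)) \<le> 2 * (sqrt s * sqrt t)"
proof (rule power2_le_imp_le)
  have pos: "0 \<le> 2 * s" "0 \<le> 2 * t"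
    using order_trans [OF sum_nonneg assms(1)] order_trans [OF sum_nonneg assms(2)] by auto
  have "(\<Sum>i\<in>A. norm (u i) * norm (v i))\<^sup>2 \<le> (\<Sum>i\<in>A. (norm (u i))\<^sup>2) * (\<Sum>i\<in>A. (norm (v i))\<^sup>2)"
    by (rule Cauchy_Schwarz_ineq_sum)
  also have "\<dots> \<le> (2 * s) * (2 * t)"
    using assms pos by (intro mult_mono) (auto intro: sum_nonneg)
  also have "\<dots> = (2 * (sqrt s * sqrt t))\<^sup>2"
    using pos by (simp add: power_mult_distrib)
  finally show "(\<Sum>i\<in>A. norm (u i) * norm (v i))\<^sup>2 \<le> (2 * (sqrt s * sqrt t))\<^sup>2" .
  show "0 \<le> 2 * (sqrt s * sqrt t)" using pos by simp
qed

text \<open>The triangle inequality for the Cygan metric on the boundary minus the point \<open>axis p 1\<close>.\<close>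

lemma cygan_triangle:
  fixes u v :: "quat ^ 'm::finite"
  assumes "p \<noteq> q" and u: "hnorm p q u = 0" "u $ q = 1" and v: "hnorm p q v = 0" "v $ q = 1"
  shows "sqrt (norm (u $ p)) \<le> sqrt (norm (v $ p)) + sqrt (norm (hform p q u v))"
proof -
  define A where "A = UNIV - {p, q}"
  define w where "w = hform p q u v"
  define \<eta> where "\<eta> i = u $ i - v $ i" for i
  have su: "(\<Sum>i\<in>A. (norm (u $ i))\<^sup>2) = 2 * qRe (u $ p)"
    and sv: "(\<Sum>i\<in>A. (norm (v $ i))\<^sup>2) = 2 * qRe (v $ p)"
    using u v by (simp_all add: hnorm_eq A_def)
  have w: "w = (\<Sum>i\<in>A. qcnj (v $ i) * u $ i) - qcnj (v $ p) - u $ p"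
    using u v by (simp add: w_def hform_def A_def algebra_simps)
  have s\<eta>: "(\<Sum>i\<in>A. (norm (\<eta> i))\<^sup>2) = - 2 * qRe w"
  proof -
    have "(norm (\<eta> i))\<^sup>2 = (norm (u $ i))\<^sup>2 + (norm (v $ i))\<^sup>2 - 2 * qRe (qcnj (v $ i) * u $ i)" for i
      unfolding \<eta>_def norm_minus_commute [of "u $ i"] norm_diff_sq by simp
    then have "(\<Sum>i\<in>A. (norm (\<eta> i))\<^sup>2) =
        2 * qRe (u $ p) + 2 * qRe (v $ p) - 2 * qRe (\<Sum>i\<in>A. qcnj (v $ i) * u $ i)"
      by (simp add: sum.distrib sum_subtractf su sv sum_distrib_left)
    then show ?thesis by (simp only: w quat_sel) simp
  qed
  have "(\<Sum>i\<in>A. qcnj (v $ i) * u $ i) =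
      (\<Sum>i\<in>A. qcnj (v $ i) * \<eta> i) + (\<Sum>i\<in>A. qcnj (v $ i) * v $ i)"
    by (simp add: \<eta>_def right_diff_distrib sum_subtractf)
  also have "(\<Sum>i\<in>A. qcnj (v $ i) * v $ i) = of_real (\<Sum>i\<in>A. (norm (v $ i))\<^sup>2)"
    by simp
  also have "\<dots> = v $ p + qcnj (v $ p)"
    unfolding sv by (simp add: quat_eq_iff del: of_real_mult)
  finally have "u $ p = v $ p + (\<Sum>i\<in>A. qcnj (v $ i) * \<eta> i) - w"
    by (simp add: w)
  then have "norm (u $ p) \<le> norm (v $ p) + norm (\<Sum>i\<in>A. qcnj (v $ i) * \<eta> i) + norm w"
    by (metis norm_triangle_ineq norm_triangle_ineq4 add_right_mono order_trans)
  also have "norm (\<Sum>i\<in>A. qcnj (v $ i) * \<eta> i) \<le> (\<Sum>i\<in>A. norm (v $ i) * norm (\<eta> i))"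
    by (rule order_trans [OF norm_sum]) (simp add: norm_mult)
  \<comment> \<open>The sums of squares are \<open>2 * qRe (v $ p)\<close> and
    \<open>- 2 * qRe w\<close>, so Cauchy-Schwarz yields exactly the cross term that completes a
    square.\<close>
  also have "\<dots> \<le> 2 * (sqrt (norm (v $ p)) * sqrt (norm w))"
    by (rule norm_sum_mult_le)
      (use qRe_le_norm [of "v $ p"] abs_qRe_le_norm [of w] in \<open>simp_all add: sv s\<eta>\<close>)
  also have "norm (v $ p) + 2 * (sqrt (norm (v $ p)) * sqrt (norm w)) + norm w =
      (sqrt (norm (v $ p)) + sqrt (norm w))\<^sup>2"
    by (simp add: power2_sum)
  finally show ?thesis
    unfolding w_def by (intro real_le_lsqrt) simp_all
qed

text \<open>Column \<open>p\<close> is isotropic, so a vanishing entry at \<open>q\<close> forces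
  its other off-diagonal entries to vanish.\<close>

lemma Sp_stab_axis:
  assumes "p \<noteq> q" "A \<in> carrier (Sp p q)" "A $ q $ p = 0"
  shows "stab_axis A p" "norm (A $ p $ p) * norm (A $ q $ q) = 1"
proof -
  have "(\<Sum>k\<in>UNIV - {p, q}. (norm (A $ k $ p))\<^sup>2) \<le> 0"
    using Sp_col_sum_le [OF assms(1,2)] assms(3) by simp
  then have "A $ k $ p = 0" if "k \<noteq> p" "k \<noteq> q" for k
    using sum_sq_eq_0_imp [of "UNIV - {p, q}" "\<lambda>k. A $ k $ p" k] that by simp
  then show st: "stab_axis A p" using assms(3) by (auto simp: stab_axis_def)
  have "(hadj p q A ** A) $ p $ p = 1" by (simp add: hadj_mult [OF assms(1,2)] mat_def)
  then show "norm (A $ p $ p) * norm (A $ q $ q) = 1"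
    using norm_eq_1_of_mult_eq_1 [of "hadj p q A $ p $ p" "A $ p $ p"]
    by (simp add: stab_axis_mult [OF st] mult.commute)
qed

text \<open>Write \<open>a\<close>, \<open>b\<close>, \<open>c\<close>, \<open>d\<close> for the
  corner entries and normalise the images of both endpoints to have coordinate 1 at
  \<open>q\<close>. Their Cygan distances to the class of \<open>axis q 1\<close> are the square
  roots of |a / c| and |b / d|, and their mutual distance is that of 1 / |c d|. Multiplying the
  triangle inequality by the square root of |c d| gives the claim; if \<open>c\<close> or
  \<open>d\<close> vanishes, an image is the excluded point.\<close>

lemma Sp_sqrt_le:
  assumes "p \<noteq> q" and A: "A \<in> carrier (Sp p q)"
  shows "sqrt (norm (A $ p $ p) * norm (A $ q $ q)) \<le> 1 + sqrt (norm (A $ p $ q) * norm (A $ q $ p))"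
proof (cases "A $ q $ p = 0 \<or> A $ q $ q = 0")
  case True
  then show ?thesis using Sp_stab_axis(2) [OF assms] by auto
next
  case False
  define c d where "c = norm (A $ q $ p)" and "d = norm (A $ q $ q)"
  have cd: "0 < c" "0 < d" using False by (simp_all add: c_def d_def)
  define u v where "u = rscale (A *v axis p 1) (inverse (A $ q $ p))"
    and "v = rscale (A *v axis q 1) (inverse (A $ q $ q))"
  have "hnorm p q (axis a 1) = 0" if "a \<in> {p, q}" for a
  proof -
    have "(\<Sum>i\<in>UNIV - {p, q}. (norm (axis a 1 $ i :: quat))\<^sup>2) = 0"
      by (rule sum.neutral) (use that in \<open>auto simp: axis_def\<close>)
    then show ?thesis using that assms(1) by (auto simp: hnorm_eq axis_def)
  qed
  then have "hnorm p q u = 0" "hnorm p q v = 0"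
    by (simp_all add: u_def v_def hnorm_rscale hnorm_Sp [OF A])
  moreover have "u $ q = 1" "v $ q = 1"
    using False by (simp_all add: u_def v_def rscale_def matrix_vector_mult_axis)
  ultimately have "sqrt (norm (u $ p)) \<le> sqrt (norm (v $ p)) + sqrt (norm (hform p q u v))"
    by (intro cygan_triangle [OF assms(1)])
  moreover have "norm (u $ p) = norm (A $ p $ p) / c" "norm (v $ p) = norm (A $ p $ q) / d"
    by (simp_all add: u_def v_def rscale_def matrix_vector_mult_axis norm_mult norm_inverse
        divide_inverse c_def d_def)
  moreover have "norm (hform p q u v) = 1 / (c * d)"
  proof -
    have "norm (hform p q (A *v axis p 1) (A *v axis q 1)) = 1"
      using A hform_axis [OF assms(1), of q "axis p 1" 1] by (simp add: Sp_def)
    then show ?thesis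
      unfolding u_def v_def hform_simps norm_mult norm_qcnj norm_inverse by (simp add: c_def d_def divide_inverse)
  qed
  ultimately have "sqrt (norm (A $ p $ p) / c) * sqrt (c * d) \<le>
      (sqrt (norm (A $ p $ q) / d) + sqrt (1 / (c * d))) * sqrt (c * d)"
    using cd by (intro mult_right_mono) auto
  then show ?thesis
    using cd unfolding distrib_right real_sqrt_mult [symmetric]
    by (simp add: c_def [symmetric] d_def [symmetric] mult.commute)
qed

text \<open>Subtracting \<open>A ** hadj p q A = mat 1\<close> replaces each
  \<open>\<kappa> k\<close> by \<open>\<kappa> k - 1\<close>. The sum over \<open>k\<close> is then
  split into the two hyperbolic directions and the rest.\<close>

lemma Sp_commutator_entry:
  assumes "p \<noteq> q" and A: "A \<in> carrier (Sp p q)"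
    and \<delta>: "\<And>k. k \<notin> {p, q} \<Longrightarrow> norm (\<kappa> k - 1) \<le> \<delta>"
  shows "norm ((A ** dmat \<kappa> ** hadj p q A) $ i $ j - mat 1 $ i $ j) \<le>
    norm (\<kappa> p - 1) * (norm (A $ i $ p) * norm (A $ sw p q j $ q)) +
    norm (\<kappa> q - 1) * (norm (A $ i $ q) * norm (A $ sw p q j $ p)) +
    \<delta> * (\<Sum>k\<in>UNIV - {p, q}. norm (A $ i $ k) * norm (A $ sw p q j $ k))"
proof -
  define T where "T k = norm (\<kappa> k - 1) * (norm (A $ i $ k) * norm (A $ sw p q j $ sw p q k))" for k
  have "(A ** dmat \<kappa> ** hadj p q A) $ i $ j - (A ** hadj p q A) $ i $ j =
      (\<Sum>k\<in>UNIV. A $ i $ k * (\<kappa> k - 1) * hadj p q A $ k $ j)"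
    unfolding matrix_matrix_mult_def [of _ "hadj p q A"]
    by (simp add: dmat_mult_right sum_subtractf [symmetric] algebra_simps)
  then have "norm ((A ** dmat \<kappa> ** hadj p q A) $ i $ j - mat 1 $ i $ j) \<le>
      (\<Sum>k\<in>UNIV. norm (A $ i $ k * (\<kappa> k - 1) * hadj p q A $ k $ j))"
    unfolding hadj_mult(2) [OF assms(1,2)] by (simp add: norm_sum)
  also have "\<dots> = sum T UNIV"
    by (intro sum.cong) (simp_all add: T_def norm_mult)
  also have "\<dots> = T p + T q + sum T (UNIV - {p, q})"
    by (simp add: sum_UNIV_split [OF assms(1), of T])
  also have "sum T (UNIV - {p, q}) \<le>
      (\<Sum>k\<in>UNIV - {p, q}. \<delta> * (norm (A $ i $ k) * norm (A $ sw p q j $ k)))"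
    unfolding T_def by (intro sum_mono) (use \<delta> in \<open>auto intro!: mult_right_mono\<close>)
  finally show ?thesis by (simp add: T_def sum_distrib_left)
qed

text \<open>The same product of two entries of row \<open>p\<close> factors out of all terms; for
  the sum over the rest of the row this is isotropy, at the cost of a factor 2, hence the
  \<open>2 * \<delta>\<close> in \<open>M\<close>.\<close>

lemma Sp_step_pq:
  assumes "p \<noteq> q" and A: "A \<in> carrier (Sp p q)"
    and \<delta>: "\<And>k. k \<notin> {p, q} \<Longrightarrow> norm (\<kappa> k - 1) \<le> \<delta>" "0 \<le> \<delta>"
    and M: "2 * \<delta> + norm (\<kappa> p - 1) + norm (\<kappa> q - 1) \<le> M"
  shows "norm ((A ** dmat \<kappa> ** hadj p q A) $ p $ q) \<le> M * (norm (A $ p $ p) * norm (A $ p $ q))"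
proof -
  define ab where "ab = norm (A $ p $ p) * norm (A $ p $ q)"
  have "norm ((A ** dmat \<kappa> ** hadj p q A) $ p $ q) \<le>
    norm (\<kappa> p - 1) * (norm (A $ p $ p) * norm (A $ p $ q)) +
    norm (\<kappa> q - 1) * (norm (A $ p $ q) * norm (A $ p $ p)) +
    \<delta> * (\<Sum>k\<in>UNIV - {p, q}. norm (A $ p $ k) * norm (A $ p $ k))"
    using Sp_commutator_entry [OF assms(1-3), where i = p and j = q] assms(1) by (simp add: mat_def)
  also have "\<delta> * (\<Sum>k\<in>UNIV - {p, q}. norm (A $ p $ k) * norm (A $ p $ k)) \<le> \<delta> * (2 * ab)"
    using Sp_row_sum_le [OF assms(1,2)] \<delta>(2)
    by (intro mult_left_mono) (simp_all add: ab_def power2_eq_square)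
  finally have "norm ((A ** dmat \<kappa> ** hadj p q A) $ p $ q) \<le>
      (2 * \<delta> + norm (\<kappa> p - 1) + norm (\<kappa> q - 1)) * ab"
    by (simp add: ab_def algebra_simps)
  also have "\<dots> \<le> M * ab"
    by (rule mult_right_mono [OF M]) (simp add: ab_def)
  finally show ?thesis by (simp add: ab_def)
qed

text \<open>Bounds the diagonal of the next iterate by the off-diagonal product alone, because
  \<open>Sp_sqrt_le\<close> bounds the diagonal product by \<open>(1 + x)\<^sup>2\<close>.\<close>

lemma Sp_step_pp:
  assumes "p \<noteq> q" and A: "A \<in> carrier (Sp p q)"
    and \<delta>: "\<And>k. k \<notin> {p, q} \<Longrightarrow> norm (\<kappa> k - 1) \<le> \<delta>" "0 \<le> \<delta>"
    and M: "2 * \<delta> + norm (\<kappa> p - 1) + norm (\<kappa> q - 1) \<le> M"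
    and x: "sqrt (norm (A $ p $ q) * norm (A $ q $ p)) \<le> x"
  shows "norm ((A ** dmat \<kappa> ** hadj p q A) $ p $ p) \<le> 1 + M * (1 + x)\<^sup>2"
proof -
  define X where "X = sqrt (norm (A $ p $ q) * norm (A $ q $ p))"
  define Y where "Y = sqrt (norm (A $ p $ p) * norm (A $ q $ q))"
  have XY: "0 \<le> X" "0 \<le> Y" "X \<le> 1 + x" "Y \<le> 1 + x"
    using x Sp_sqrt_le [OF assms(1,2)] by (simp_all add: X_def Y_def)
  have "(\<Sum>k\<in>UNIV - {p, q}. norm (A $ p $ k) * norm (A $ q $ k)) \<le>
      2 * (sqrt (norm (A $ p $ p) * norm (A $ p $ q)) * sqrt (norm (A $ q $ q) * norm (A $ q $ p)))"
    by (rule norm_sum_mult_le)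
      (use Sp_row_sum_le [OF assms(1,2)] Sp_row_sum_le [of q p A] A assms(1) in
        \<open>simp_all add: Sp_commute [of q p] insert_commute\<close>)
  also have "\<dots> = 2 * (X * Y)"
    unfolding X_def Y_def real_sqrt_mult [symmetric] by (simp add: ac_simps)
  finally have s: "(\<Sum>k\<in>UNIV - {p, q}. norm (A $ p $ k) * norm (A $ q $ k)) \<le> 2 * (X * Y)" .
  have "norm ((A ** dmat \<kappa> ** hadj p q A) $ p $ p - 1) \<le>
    norm (\<kappa> p - 1) * (norm (A $ p $ p) * norm (A $ q $ q)) +
    norm (\<kappa> q - 1) * (norm (A $ p $ q) * norm (A $ q $ p)) +
    \<delta> * (\<Sum>k\<in>UNIV - {p, q}. norm (A $ p $ k) * norm (A $ q $ k))"
    using Sp_commutator_entry [OF assms(1-3), where i = p and j = p] by (simp add: mat_def)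
  also have "\<dots> \<le> norm (\<kappa> p - 1) * (Y * Y) + norm (\<kappa> q - 1) * (X * X) + \<delta> * (2 * (X * Y))"
    using s \<delta>(2) by (simp add: X_def Y_def mult_left_mono)
  also have "\<dots> \<le> norm (\<kappa> p - 1) * ((1 + x) * (1 + x)) + norm (\<kappa> q - 1) * ((1 + x) * (1 + x)) +
      \<delta> * (2 * ((1 + x) * (1 + x)))"
    using XY \<delta>(2) by (intro add_mono mult_left_mono mult_mono) auto
  also have "\<dots> = (2 * \<delta> + norm (\<kappa> p - 1) + norm (\<kappa> q - 1)) * (1 + x)\<^sup>2"
    by (simp add: power2_eq_square algebra_simps)
  also have "\<dots> \<le> M * (1 + x)\<^sup>2"
    by (rule mult_right_mono [OF M]) simp
  finally show ?thesis
    using norm_triangle_sub [of "(A ** dmat \<kappa> ** hadj p q A) $ p $ p" 1] by simp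
qed

lemma (in discrete_lox) balance_le:
  assumes A: "A \<in> G" and "A $ q $ p \<noteq> 0" and le: "norm (A $ q $ p) \<le> norm (A $ p $ q)"
  shows "\<exists>B\<in>G. norm (B $ p $ p) = norm (A $ p $ p) \<and> norm (B $ q $ q) = norm (A $ q $ q) \<and>
    norm (B $ p $ q) * norm (B $ q $ p) = norm (A $ p $ q) * norm (A $ q $ p) \<and>
    norm (B $ p $ q) \<le> (norm (\<mu> p))\<^sup>2 * sqrt (norm (A $ p $ q) * norm (A $ q $ p)) \<and>
    norm (B $ q $ p) \<le> (norm (\<mu> p))\<^sup>2 * sqrt (norm (A $ p $ q) * norm (A $ q $ p))"
proof -
  define b c where "b = norm (A $ p $ q)" and "c = norm (A $ q $ p)"
  have bc: "0 < c" "c \<le> b" using assms by (simp_all add: b_def c_def)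
  define K where "K = (norm (\<mu> p))\<^sup>2"
  have "1 < K" using norm_p by (simp add: K_def)
  \<comment> \<open>The two entries would get equal norm if \<open>K ^ n\<close> were
    \<open>sqrt (b / c)\<close>; rounding down costs at most one factor \<open>K\<close>.\<close>
  then obtain n where n: "K ^ n \<le> sqrt (b / c)" "sqrt (b / c) < K ^ Suc n"
    using ex_power_bracket [of K "sqrt (b / c)"] bc by auto
  define B where "B = cnj_pow n A"
  have "\<mu> p \<noteq> 0" using norm_p by auto
  then have "norm (\<mu> q) * norm (\<mu> p) = 1" using norm_q by simp
  then have pp: "norm (B $ p $ p) = norm (A $ p $ p)" "norm (B $ q $ q) = norm (A $ q $ q)"
    by (simp_all add: B_def norm_cnj_pow mult.commute)
  have Bqp: "norm (B $ q $ p) = K ^ n * c"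
    by (simp add: B_def norm_cnj_pow c_def K_def power2_eq_square)
  have Bpq: "norm (B $ p $ q) = b / K ^ n"
    using norm_p by (simp add: B_def norm_cnj_pow b_def K_def norm_q power2_eq_square power_divide)
  have sq: "sqrt (b / c) * c = sqrt (b * c)" "sqrt (b * c) * sqrt (b / c) = b"
    using bc by (simp_all add: real_sqrt_divide real_sqrt_mult field_simps)
  have "K ^ n * c \<le> sqrt (b / c) * c" using n bc by (intro mult_right_mono) auto
  then have 1: "norm (B $ q $ p) \<le> sqrt (b * c)" by (simp add: Bqp sq)
  have "b \<le> sqrt (b * c) * K ^ Suc n"
    using mult_left_mono [OF less_imp_le [OF n(2)], of "sqrt (b * c)"] bc by (simp add: sq)
  then have 2: "norm (B $ p $ q) \<le> K * sqrt (b * c)"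
    using \<open>1 < K\<close> by (simp add: Bpq divide_le_eq mult.commute mult.left_commute)
  have "1 * sqrt (b * c) \<le> K * sqrt (b * c)"
    using \<open>1 < K\<close> bc by (intro mult_right_mono) auto
  with 1 have 3: "norm (B $ q $ p) \<le> K * sqrt (b * c)" by simp
  have "norm (B $ p $ q) * norm (B $ q $ p) = b * c"
    using \<open>1 < K\<close> by (simp add: Bpq Bqp)
  with pp 2 3 show ?thesis
    using cnj_pow_in [OF A] unfolding b_def c_def K_def B_def by blast
qed

lemma (in discrete_lox) balance:
  assumes A: "A \<in> G" and nz: "A $ q $ p \<noteq> 0" "A $ p $ q \<noteq> 0"
  shows "\<exists>B\<in>G. norm (B $ p $ p) = norm (A $ p $ p) \<and> norm (B $ q $ q) = norm (A $ q $ q) \<and>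
    norm (B $ p $ q) * norm (B $ q $ p) = norm (A $ p $ q) * norm (A $ q $ p) \<and>
    norm (B $ p $ q) \<le> (norm (\<mu> p))\<^sup>2 * sqrt (norm (A $ p $ q) * norm (A $ q $ p)) \<and>
    norm (B $ q $ p) \<le> (norm (\<mu> p))\<^sup>2 * sqrt (norm (A $ p $ q) * norm (A $ q $ p))"
proof (cases "norm (A $ q $ p) \<le> norm (A $ p $ q)")
  case False
  interpret inv: discrete_lox q p G "\<lambda>i. qcnj (\<mu> (sw p q i))" by (rule swapped)
  show ?thesis using inv.balance_le [OF A nz(2)] False by (auto simp: mult.commute)
qed (use balance_le [OF A nz(1)] in blast)

section \<open>Iterated conjugation\<close>

context torsion_free_lox
begin

text \<open>Runs the iteration backwards. The conjugate fixes both endpoints, so the inverse of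
  \<open>k\<close> maps them to boundary fixed points of \<open>dmat \<kappa>\<close>, which are the
  endpoints again. An exchange is excluded by \<open>no_swap\<close>; otherwise one of them is
  fixed, and hence both.\<close>

lemma stab_axis_of_conj:
  assumes k: "k \<in> G" and \<kappa>: "1 < norm (\<kappa> p)" "\<And>i. i \<noteq> p \<Longrightarrow> norm (\<kappa> i) \<le> 1"
    "\<And>i. i \<noteq> q \<Longrightarrow> 1 \<le> norm (\<kappa> i)" "norm (\<kappa> q) < 1"
    and X: "k ** dmat \<kappa> ** hadj p q k \<in> G" "stab_axis (k ** dmat \<kappa> ** hadj p q k) p"
  shows "stab_axis k p"
proof -
  define B where "B = hadj p q k"
  have B: "B \<in> G" "hadj p q B = k" using k G_hadj by (simp_all add: B_def)
  have eig: "(\<forall>i. i \<noteq> p \<longrightarrow> B $ i $ c = 0) \<or> (\<forall>i. i \<noteq> q \<longrightarrow> B $ i $ c = 0)" if "c \<in> {p, q}" for c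
  proof -
    define X where "X = k ** dmat \<kappa> ** B"
    have st: "stab_axis X c"
      using that assms(6,7) stab_axis_iff by (auto simp: X_def B_def)
    \<comment> \<open>Column \<open>c\<close> of \<open>B\<close> is an eigenvector of
      \<open>dmat \<kappa>\<close>. The norms at \<open>p\<close> and \<open>q\<close> are the
      strict maximum and minimum, so a non-zero entry at \<open>p\<close> or \<open>q\<close> is the
      only one in the column.\<close>
    have "B ** X = dmat \<kappa> ** B"
      by (simp add: X_def B_def matrix_mul_assoc G_hadj_mult k)
    then have "B $ i $ c * X $ c $ c = \<kappa> i * B $ i $ c" for i
      using stab_axis_mult [OF st, of B i] by (simp add: dmat_mult_left)
    then have n: "norm (B $ i $ c) * norm (X $ c $ c) = norm (\<kappa> i) * norm (B $ i $ c)" for i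
      by (metis norm_mult)
    show ?thesis
    proof (cases "B $ p $ c = 0")
      case False
      then have "norm (X $ c $ c) = norm (\<kappa> p)" using n [of p] by simp
      then have "B $ i $ c = 0" if "i \<noteq> p" for i using n [of i] \<kappa>(1) \<kappa>(2) [OF that] by auto
      then show ?thesis by blast
    next
      case True
      have carr: "B \<in> carrier (Sp p q)" by (rule G_Sp [OF B(1)])
      show ?thesis
      proof (cases "B $ q $ c = 0")
        case False
        then have "norm (X $ c $ c) = norm (\<kappa> q)" using n [of q] by simp
        then have "B $ i $ c = 0" if "i \<noteq> q" for i using n [of i] \<kappa>(4) \<kappa>(3) [OF that] by auto
        then show ?thesis by blast
      next
        case zero: True
        have "stab_axis B p \<and> c = p \<or> stab_axis B q \<and> c = q"
          using Sp_stab_axis(1) [OF pq carr] Sp_stab_axis(1) [of q p B] carr True zero that pq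
          by (auto simp: Sp_commute [of q p])
        then show ?thesis by (auto simp: stab_axis_def)
      qed
    qed
  qed
  consider "stab_axis B p" | "stab_axis B q"
    | "\<forall>i. i \<noteq> q \<longrightarrow> B $ i $ p = 0" "\<forall>i. i \<noteq> p \<longrightarrow> B $ i $ q = 0"
    using eig [of p] eig [of q] unfolding stab_axis_def by blast
  then have "stab_axis B p"
  proof cases
    case 3
    then show ?thesis using no_swap [OF B(1)] by blast
  qed (use stab_axis_iff [OF B(1)] in auto)
  then show ?thesis using stab_axis_hadj(1) [OF B(1)] by (simp add: B(2))
qed

text \<open>With \<open>x\<^sub>j = sqrt \<bar>b\<^sub>j c\<^sub>j\<bar>\<close> for the iterates \<open>h\<^sub>j\<^sub>+\<^sub>1 = h\<^sub>j f h\<^sub>j\<^sup>-\<^sup>1\<close>, the first step gives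
  \<open>M * (1 + x\<^sub>1) < 1\<close> and from then on \<open>x\<^sub>j\<close> decreases. After balancing by powers of \<open>g\<close> the iterates stay
  bounded, so by discreteness \<open>x\<^sub>j\<close> takes finitely many values and eventually vanishes.\<close>

lemma jorgensen:
  assumes h: "h \<in> G" and f: "dmat \<kappa> \<in> G"
    and \<kappa>: "1 < norm (\<kappa> p)" "norm (\<kappa> q) = 1 / norm (\<kappa> p)" "\<And>i. i \<notin> {p, q} \<Longrightarrow> norm (\<kappa> i) = 1"
    and \<delta>: "\<And>k. k \<notin> {p, q} \<Longrightarrow> norm (\<kappa> k - 1) \<le> \<delta>" "0 \<le> \<delta>"
    and M: "2 * \<delta> + norm (\<kappa> p - 1) + norm (\<kappa> q - 1) \<le> M" "0 < M"
    and small: "norm (h $ p $ p) * norm (h $ q $ q) + norm (h $ p $ q) * norm (h $ q $ p) <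
      2 * (1 - M) / M\<^sup>2"
  shows "stab_axis h p"
proof -
  define step where "step A = A ** dmat \<kappa> ** hadj p q A" for A
  define hs where "hs j = (step ^^ j) h" for j :: nat
  have hs0: "hs 0 = h" and hsSuc: "hs (Suc j) = hs j ** dmat \<kappa> ** hadj p q (hs j)" for j
    by (simp_all add: hs_def step_def)
  have hs: "hs j \<in> G" for j
    by (induction j) (simp_all add: hs0 hsSuc h f G_mult G_hadj)
  have carr: "hs j \<in> carrier (Sp p q)" "hs j \<in> carrier (Sp q p)" for j
    using G_Sp [OF hs] by (simp_all add: Sp_commute)
  define x where "x j = sqrt (norm (hs j $ p $ q) * norm (hs j $ q $ p))" for j
  define y where "y j = sqrt (norm (hs j $ p $ p) * norm (hs j $ q $ q))" for j
  have xy0: "0 \<le> x j" "0 \<le> y j" for j by (simp_all add: x_def y_def)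
  have y_le: "y j \<le> 1 + x j" for j
    unfolding x_def y_def by (rule Sp_sqrt_le [OF pq carr(1)])
  have \<delta>': "\<And>k. k \<notin> {q, p} \<Longrightarrow> norm (\<kappa> k - 1) \<le> \<delta>" and M': "2 * \<delta> + norm (\<kappa> q - 1) + norm (\<kappa> p - 1) \<le> M"
    using \<delta>(1) M(1) by auto
  have x_step: "x (Suc j) \<le> M * (x j * y j)" for j
  proof -
    let ?a = "norm (hs j $ p $ p)" and ?b = "norm (hs j $ p $ q)"
      and ?c = "norm (hs j $ q $ p)" and ?d = "norm (hs j $ q $ q)"
    have "norm (hs (Suc j) $ p $ q) * norm (hs (Suc j) $ q $ p) \<le> (M * (?a * ?b)) * (M * (?d * ?c))"
      using Sp_step_pq [OF pq carr(1) \<delta> M(1), of j]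
        Sp_step_pq [OF pq [symmetric] carr(2) \<delta>' \<delta>(2) M', of j] M(2)
      by (intro mult_mono) (simp_all add: hsSuc hadj_commute [of q p])
    also have "\<dots> = (M * (x j * y j))\<^sup>2"
      by (simp add: x_def y_def power_mult_distrib) (simp add: power2_eq_square)
    finally show ?thesis
      unfolding x_def [of "Suc j"] by (intro real_le_lsqrt) (simp_all add: M(2) xy0 less_imp_le)
  qed
  \<comment> \<open>By \<open>x_step\<close>, \<open>x 1\<close> is at most \<open>M\<close> times
    \<open>x 0 * y 0\<close>, and this product is at most half the sum bounded in
    \<open>small\<close>.\<close>
  have x1: "M * (1 + x 1) < 1"
  proof -
    have "x 0 * x 0 + y 0 * y 0 < 2 * (1 - M) / M\<^sup>2"
      using small by (simp add: x_def y_def hs0 add.commute)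
    then have "M\<^sup>2 * (x 0 * x 0 + y 0 * y 0) < 2 * (1 - M)"
      using M(2) by (simp add: field_simps)
    moreover have "2 * (x 0 * y 0) \<le> x 0 * x 0 + y 0 * y 0"
      using sum_squares_bound [of "x 0" "y 0"] by (simp add: power2_eq_square)
    then have "M\<^sup>2 * (2 * (x 0 * y 0)) \<le> M\<^sup>2 * (x 0 * x 0 + y 0 * y 0)"
      by (intro mult_left_mono) auto
    moreover have "M * x 1 \<le> M * (M * (x 0 * y 0))"
      using x_step [of 0] M(2) by (intro mult_left_mono) auto
    ultimately show ?thesis by (simp add: power2_eq_square algebra_simps)
  qed
  define \<theta> where "\<theta> = M * (1 + x 1)"
  have \<theta>: "0 < \<theta>" "\<theta> < 1" using x1 M(2) xy0 [of 1] by (simp_all add: \<theta>_def add_pos_nonneg)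
  have dec: "x (Suc j) \<le> \<theta> * x j" if "x j \<le> x 1" for j
  proof -
    have "x (Suc j) \<le> M * (x j * y j)" by (rule x_step)
    also have "\<dots> \<le> M * (x j * (1 + x 1))"
      using that y_le [of j] xy0 M(2) by (intro mult_left_mono) auto
    finally show ?thesis by (simp add: \<theta>_def algebra_simps)
  qed
  have x_le: "x (Suc j) \<le> x 1" for j
  proof (induction j)
    case (Suc j)
    have "\<theta> * x (Suc j) \<le> x (Suc j)" using \<theta> xy0 by (intro mult_left_le_one_le) auto
    then show ?case using dec [OF Suc] Suc by linarith
  qed simp
  \<comment> \<open>The diagonal of an iterate is bounded through \<open>x\<close> at its
    predecessor, and \<open>x_le\<close> bounds \<open>x\<close> from index 1 on; hence the start at
    index 2.\<close>
  have "\<exists>j. x (Suc (Suc j)) = 0"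
  proof (rule ccontr)
    assume "\<not> (\<exists>j. x (Suc (Suc j)) = 0)"
    then have pos: "0 < x (Suc (Suc j))" for j using xy0 by (metis less_eq_real_def)
    have strict: "x (Suc (Suc (Suc j))) < x (Suc (Suc j))" for j
    proof -
      have "\<theta> * x (Suc (Suc j)) < 1 * x (Suc (Suc j))"
        using \<theta> pos by (intro mult_strict_right_mono) auto
      then show ?thesis using dec [OF x_le, of "Suc j"] by simp
    qed
    \<comment> \<open>The first two summands bound the diagonal entries, the last one the
      off-diagonal entries after balancing.\<close>
    define K where "K = 1 + M * (1 + x 1)\<^sup>2 + (norm (\<mu> p))\<^sup>2 * x 1"
    have K: "1 + M * (1 + x 1)\<^sup>2 \<le> K" "(norm (\<mu> p))\<^sup>2 * x 1 \<le> K" "1 \<le> K"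
      using M(2) xy0 [of 1] by (simp_all add: K_def)
    define F where "F = {A \<in> G. \<forall>i\<in>{p, q}. \<forall>j\<in>{p, q}. norm (A $ i $ j) \<le> K}"
    have "finite F" unfolding F_def by (rule finite_bounded_block [OF K(3)])
    have in_F: "x (Suc (Suc j)) \<in> (\<lambda>A. sqrt (norm (A $ p $ q) * norm (A $ q $ p))) ` F" for j
    proof -
      let ?A = "hs (Suc (Suc j))"
      have le: "sqrt (norm (hs (Suc j) $ p $ q) * norm (hs (Suc j) $ q $ p)) \<le> x 1"
        using x_le [of j] by (simp add: x_def)
      then have le': "sqrt (norm (hs (Suc j) $ q $ p) * norm (hs (Suc j) $ p $ q)) \<le> x 1"
        by (simp add: mult.commute)
      have diag: "norm (?A $ p $ p) \<le> K" "norm (?A $ q $ q) \<le> K"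
        using Sp_step_pp [OF pq carr(1) \<delta> M(1) le] K(1)
          Sp_step_pp [OF pq [symmetric] carr(2) \<delta>' \<delta>(2) M' le']
        by (simp_all add: hsSuc [of "Suc j"] hadj_commute [of q p])
      have "?A $ q $ p \<noteq> 0" "?A $ p $ q \<noteq> 0"
        using pos [of j] by (auto simp: x_def)
      then obtain B where B: "B \<in> G" "norm (B $ p $ p) = norm (?A $ p $ p)" "norm (B $ q $ q) = norm (?A $ q $ q)"
        "norm (B $ p $ q) * norm (B $ q $ p) = norm (?A $ p $ q) * norm (?A $ q $ p)"
        "norm (B $ p $ q) \<le> (norm (\<mu> p))\<^sup>2 * x (Suc (Suc j))"
        "norm (B $ q $ p) \<le> (norm (\<mu> p))\<^sup>2 * x (Suc (Suc j))"
        using balance [OF hs, of "Suc (Suc j)"] unfolding x_def by blast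
      have "(norm (\<mu> p))\<^sup>2 * x (Suc (Suc j)) \<le> K"
        using mult_left_mono [OF x_le [of "Suc j"], of "(norm (\<mu> p))\<^sup>2"] K(2) by simp
      then have "B \<in> F" using B diag by (auto simp: F_def)
      moreover have "x (Suc (Suc j)) = sqrt (norm (B $ p $ q) * norm (B $ q $ p))"
        by (simp add: x_def B(4))
      ultimately show ?thesis by blast
    qed
    have "strict_mono (\<lambda>j. - x (Suc (Suc j)))"
      using strict by (auto simp: strict_mono_Suc_iff)
    then have "inj (\<lambda>j. - x (Suc (Suc j)))" by (rule strict_mono_imp_inj_on)
    then have "inj (\<lambda>j. x (Suc (Suc j)))" by (simp add: inj_def)
    moreover have "finite (range (\<lambda>j. x (Suc (Suc j))))"
      by (rule finite_subset [OF _ finite_imageI [OF \<open>finite F\<close>]]) (use in_F in blast)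
    ultimately show False using finite_imageD infinite_UNIV_nat by blast
  qed
  then obtain j where "x (Suc (Suc j)) = 0" by blast
  \<comment> \<open>Each alternative fixes one endpoint, and \<open>stab_axis_iff\<close> supplies
    the other.\<close>
  then have "hs (Suc (Suc j)) $ p $ q = 0 \<or> hs (Suc (Suc j)) $ q $ p = 0" by (simp add: x_def)
  then have "stab_axis (hs (Suc (Suc j))) p"
    using Sp_stab_axis(1) [OF pq carr(1)] Sp_stab_axis(1) [OF pq [symmetric] carr(2)]
      stab_axis_iff [OF hs] by blast
  moreover have "stab_axis (hs i) p" if "stab_axis (hs (Suc i)) p" for i
  proof (rule stab_axis_of_conj [OF hs, of \<kappa>])
    show "norm (\<kappa> i) \<le> 1" if "i \<noteq> p" for i
      using \<kappa> that by (cases "i = q") (auto simp: divide_le_eq)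
    show "1 \<le> norm (\<kappa> i)" if "i \<noteq> q" for i
      using \<kappa> that by (cases "i = p") auto
    show "norm (\<kappa> q) < 1" using \<kappa> by (simp add: divide_less_eq)
  qed (use that \<kappa> hs [of "Suc i"] in \<open>simp_all add: hsSuc\<close>)
  ultimately have "stab_axis (hs (Suc (Suc j) - i)) p" for i
  proof (induction i)
    case (Suc i)
    then show ?case
      by (cases "i < Suc (Suc j)") (metis Suc_diff_Suc, simp)
  qed simp
  from this [of "Suc (Suc j)"] show ?thesis by (simp add: hs0)
qed

end

section \<open>Powers close to the identity\<close>

lemma dmat_pow: "dmat \<mu> [^]\<^bsub>Sp p q\<^esub> (k :: nat) = dmat (\<lambda>i. \<mu> i ^ k)"
proof -
  interpret group "Sp p q" by (rule group_Sp)
  show ?thesis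
  proof (induction k)
    case 0
    have "\<one>\<^bsub>Sp p q\<^esub> = mat 1" by (simp add: Sp_def)
    then show ?case by (simp add: dmat_one)
  next
    case (Suc k)
    have "dmat \<mu> [^]\<^bsub>Sp p q\<^esub> Suc k = dmat \<mu> [^]\<^bsub>Sp p q\<^esub> k ** dmat \<mu>"
      by simp (simp add: Sp_def)
    then show ?case by (simp add: Suc dmat_mult power_Suc2 del: power_Suc)
  qed
qed

lemma qcnj_power: "qcnj (x ^ k) = qcnj x ^ k"
  by (induction k) (simp_all add: power_commutes)

text \<open>A unit quaternion satisfies \<open>u * u = (2 * qRe u) *\<^sub>R u - 1\<close>, so the
  real parts of its powers obey the recursion of the cosines of multiples of an angle.\<close>

lemma unit_quat_power_angle:
  assumes "norm u = 1"
  obtains \<theta> where "\<And>k. qRe (u ^ k) = cos (real k * \<theta>)"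
proof -
  define \<theta> where "\<theta> = arccos (qRe u)"
  have "\<bar>qRe u\<bar> \<le> 1" using abs_qRe_le_norm [of u] assms by simp
  then have c: "cos \<theta> = qRe u" by (simp add: \<theta>_def cos_arccos_abs)
  have n: "(qRe u)\<^sup>2 + (qI u)\<^sup>2 + (qJ u)\<^sup>2 + (qK u)\<^sup>2 = 1"
    using assms norm_quat_sq [of u] by simp
  then have u2: "u * u = (2 * qRe u) *\<^sub>R u - 1"
    by (auto simp: quat_eq_iff quat_mult_sel power2_eq_square algebra_simps)
  have "qRe (u ^ k) = cos (real k * \<theta>)" for k
  proof (induction k rule: induct_nat_012)
    case (ge2 k)
    have "u ^ Suc (Suc k) = (u * u) * u ^ k" by (simp add: mult.assoc)
    also have "\<dots> = (2 * qRe u) *\<^sub>R u ^ Suc k - u ^ k"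
      by (simp add: u2 left_diff_distrib)
    finally have "qRe (u ^ Suc (Suc k)) = 2 * cos \<theta> * cos (real (Suc k) * \<theta>) - cos (real k * \<theta>)"
      using ge2 by (simp add: c)
    also have "\<dots> = cos (real (Suc (Suc k)) * \<theta>)"
    proof -
      have "cos (real (Suc k) * \<theta> + \<theta>) + cos (real (Suc k) * \<theta> - \<theta>) =
          2 * cos \<theta> * cos (real (Suc k) * \<theta>)"
        by (simp only: cos_add cos_diff) simp
      moreover have "real (Suc k) * \<theta> + \<theta> = real (Suc (Suc k)) * \<theta>" "real (Suc k) * \<theta> - \<theta> = real k * \<theta>"
        by (simp_all add: algebra_simps)
      ultimately show ?thesis by simp
    qed
    finally show ?case .
  qed (simp_all add: c)
  then show ?thesis by (rule that)
qed

text \<open>Dirichlet's theorem is applied to the angles divided by \<open>2 * pi\<close>: an error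
  below \<open>1 / N\<close> becomes an angle of at most \<open>2 * pi / N\<close> modulo
  \<open>2 * pi\<close>.\<close>

lemma dirichlet_unit_quat:
  fixes u :: "'a \<Rightarrow> quat"
  assumes "finite I" and u: "\<And>i. i \<in> I \<Longrightarrow> norm (u i) = 1" and "2 \<le> N"
  obtains k :: nat where "0 < k" "k \<le> N ^ card I" "\<And>i. i \<in> I \<Longrightarrow> cos (2 * pi / real N) \<le> qRe (u i ^ k)"
proof -
  have "\<exists>\<theta>. \<forall>k. qRe (u i ^ k) = cos (real k * \<theta>)" if "i \<in> I" for i
    using unit_quat_power_angle [OF u [OF that]] by metis
  then obtain \<theta> where \<theta>: "\<And>i k. i \<in> I \<Longrightarrow> qRe (u i ^ k) = cos (real k * \<theta> i)" by metis
  obtain e where e: "bij_betw e {..<card I} I"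
    using ex_bij_betw_nat_finite [OF assms(1)] by (auto simp: atLeast0LessThan)
  obtain Q P where Q: "0 < Q" "Q \<le> int (N ^ card I)"
    and P: "\<And>j. j < card I \<Longrightarrow> \<bar>of_int Q * (\<theta> (e j) / (2 * pi)) - of_int (P j)\<bar> < 1 / real N"
    using Dirichlet_approx_simult [of N "card I" "\<lambda>j. \<theta> (e j) / (2 * pi)"] assms(3) by auto
  define k where "k = nat Q"
  have k: "0 < k" "k \<le> N ^ card I" "of_int Q = real k"
    using Q by (auto simp: k_def nat_le_iff)
  have "cos (2 * pi / real N) \<le> qRe (u i ^ k)" if "i \<in> I" for i
  proof -
    obtain j where j: "j < card I" "i = e j" using e \<open>i \<in> I\<close> by (auto simp: bij_betw_def)
    define x where "x = real k * \<theta> i - 2 * pi * of_int (P j)"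
    have "x = 2 * pi * (real k * (\<theta> i / (2 * pi)) - of_int (P j))"
      by (simp add: x_def field_simps)
    then have "\<bar>x\<bar> = 2 * pi * \<bar>real k * (\<theta> i / (2 * pi)) - of_int (P j)\<bar>"
      by (simp add: abs_mult)
    also have "\<dots> \<le> 2 * pi * (1 / real N)"
      using P [OF j(1)] j(2) k(3) by (intro mult_left_mono) auto
    finally have "\<bar>x\<bar> \<le> 2 * pi / real N" by simp
    \<comment> \<open>Keeps both angles in the interval where cosine is decreasing.\<close>
    moreover have "2 * pi / real N \<le> pi" using assms(3) by (simp add: field_simps)
    ultimately have "cos (2 * pi / real N) \<le> cos \<bar>x\<bar>" by (intro cos_monotone_0_pi_le) auto
    also have "cos \<bar>x\<bar> = cos (real k * \<theta> i)"
      by (simp add: x_def cos_diff)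
    finally show ?thesis using \<theta> [OF that] by simp
  qed
  with k show ?thesis using that by blast
qed

lemma norm_unit_minus_1_le:
  assumes "norm u = 1" "c \<le> qRe u"
  shows "norm (u - 1) \<le> sqrt (2 * (1 - c))"
proof (rule real_le_rsqrt)
  show "(norm (u - 1))\<^sup>2 \<le> 2 * (1 - c)"
    unfolding norm_diff_sq using assms by simp
qed

text \<open>The second norm is the first divided by \<open>r\<close>, so the sum is
  \<open>1 + 1 / r\<close> times the first; its square, rewritten with \<open>cosh (ln r)\<close>,
  is the origin of the first term of \<open>R_const\<close>.\<close>

lemma norm_lox_minus_1_sum:
  assumes "norm u = 1" "0 < r"
  shows "norm (r *\<^sub>R u - 1) + norm (inverse (qcnj (r *\<^sub>R u)) - 1) =
    2 * sqrt ((cosh (ln r) + 1) * (cosh (ln r) - qRe u))"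
proof -
  define z where "z = r *\<^sub>R u"
  have z: "norm z = r" "z \<noteq> 0" using assms by (auto simp: z_def)
  have sq: "(norm (z - 1))\<^sup>2 = r\<^sup>2 + 1 - 2 * r * qRe u"
    unfolding norm_diff_sq z(1) by (simp add: z_def)
  have "inverse (qcnj z) - 1 = inverse (qcnj z) * qcnj (1 - z)"
    using z by (simp add: right_diff_distrib)
  then have "norm (inverse (qcnj z) - 1) = norm (z - 1) / r"
    by (simp add: norm_mult norm_inverse z norm_minus_commute divide_inverse del: qcnj_simps)
  then have "norm (z - 1) + norm (inverse (qcnj z) - 1) = (1 + 1 / r) * norm (z - 1)"
    by (simp add: algebra_simps)
  also have "\<dots> = sqrt (((1 + 1 / r) * norm (z - 1))\<^sup>2)"
    using assms(2) by (simp add: abs_mult)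
  also have "((1 + 1 / r) * norm (z - 1))\<^sup>2 = 4 * ((cosh (ln r) + 1) * (cosh (ln r) - qRe u))"
    unfolding power_mult_distrib sq cosh_ln_real [OF assms(2)]
    using assms(2) by (simp add: field_simps power2_eq_square)
  also have "sqrt \<dots> = 2 * sqrt ((cosh (ln r) + 1) * (cosh (ln r) - qRe u))"
    by (simp add: real_sqrt_mult)
  finally show ?thesis by (simp add: z_def)
qed

text \<open>Inverting and conjugating preserves the direction of a quaternion, so the entry at
  \<open>q\<close> shares its angle with the one at \<open>p\<close>. The \<open>n\<close> indices
  other than \<open>q\<close> remain to be approximated, whence \<open>k \<le> N ^ n\<close>;
  monotonicity of \<open>cosh\<close> then replaces \<open>k\<close> by
  \<open>N ^ n\<close>.\<close>

lemma lox_power_close: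
  fixes lam :: "'m::finite \<Rightarrow> quat"
  assumes "p \<noteq> q" and card: "CARD('m) = n + 1" and "2 \<le> N"
    and unit: "\<And>i. i \<notin> {p, q} \<Longrightarrow> norm (lam i) = 1" and big: "1 < norm (lam p)"
  obtains k :: nat and \<delta> where "0 < k" "0 \<le> \<delta>"
    "\<And>i. i \<notin> {p, q} \<Longrightarrow> norm (lam i ^ k - 1) \<le> \<delta>"
    "2 * \<delta> + norm (lam p ^ k - 1) + norm (inverse (qcnj (lam p)) ^ k - 1) \<le>
      R_const N n (2 * ln (norm (lam p)))"
proof -
  define c where "c = cos (2 * pi / real N)"
  define \<Lambda> where "\<Lambda> = norm (lam p)"
  define u where "u i = (1 / norm (lam i)) *\<^sub>R lam i" for i
  have u: "norm (u i) = 1" if "i \<in> UNIV - {q}" for i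
    using that unit [of i] big by (cases "i = p") (auto simp: u_def)
  have "card (UNIV - {q}) = n" using card by simp
  then obtain k where k: "0 < k" "k \<le> N ^ n" and c: "\<And>i. i \<in> UNIV - {q} \<Longrightarrow> c \<le> qRe (u i ^ k)"
    using dirichlet_unit_quat [of "UNIV - {q}" u N] u assms(3) unfolding c_def by auto
  define \<delta> where "\<delta> = sqrt (2 * (1 - c))"
  have "0 \<le> \<delta>" by (simp add: \<delta>_def c_def)
  moreover have "norm (lam i ^ k - 1) \<le> \<delta>" if "i \<notin> {p, q}" for i
    unfolding \<delta>_def
  proof (rule norm_unit_minus_1_le)
    show "norm (lam i ^ k) = 1" using unit [OF that] by (simp add: norm_power)
    show "c \<le> qRe (lam i ^ k)" using c [of i] unit [OF that] that by (simp add: u_def)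
  qed
  moreover have "norm (lam p ^ k - 1) + norm (inverse (qcnj (lam p)) ^ k - 1) + 2 * \<delta> \<le>
      R_const N n (2 * ln (norm (lam p)))"
  proof -
    define r where "r = \<Lambda> ^ k"
    have \<Lambda>: "1 < \<Lambda>" using big by (simp add: \<Lambda>_def)
    then have r: "0 < r" by (simp add: r_def)
    have "lam p = \<Lambda> *\<^sub>R u p" using big by (auto simp: u_def \<Lambda>_def)
    then have "lam p ^ k = r *\<^sub>R u p ^ k" by (metis r_def scaleR_power)
    moreover have "inverse (qcnj (lam p)) ^ k = inverse (qcnj (lam p ^ k))"
      by (simp add: qcnj_power power_inverse)
    ultimately have "norm (lam p ^ k - 1) + norm (inverse (qcnj (lam p)) ^ k - 1) =
        2 * sqrt ((cosh (ln r) + 1) * (cosh (ln r) - qRe (u p ^ k)))"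
      using norm_lox_minus_1_sum [of "u p ^ k" r] r u [of p] assms(1) by (simp add: norm_power)
    also have "\<dots> \<le> 2 * sqrt ((cosh (real N ^ n * ln \<Lambda>) + 1) * (cosh (real N ^ n * ln \<Lambda>) - c))"
    proof -
      have lnr: "ln r = real k * ln \<Lambda>" using \<Lambda> by (simp add: r_def ln_realpow)
      have "real k \<le> real N ^ n" using k(2) by (metis of_nat_le_iff of_nat_power)
      then have "real k * ln \<Lambda> \<le> real N ^ n * ln \<Lambda>" using \<Lambda> by (intro mult_right_mono) auto
      then have "cosh (ln r) \<le> cosh (real N ^ n * ln \<Lambda>)"
        unfolding lnr using \<Lambda> by (subst cosh_real_nonneg_le_iff) auto
      moreover have "qRe (u p ^ k) \<le> 1"
        using qRe_le_norm [of "u p ^ k"] u [of p] assms(1) by (simp add: norm_power)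
      moreover have "1 \<le> cosh (ln r)" by (rule cosh_real_ge_1)
      ultimately show ?thesis
        using c [of p] assms(1) by (intro mult_left_mono real_sqrt_le_mono mult_mono diff_mono add_mono) auto
    qed
    finally show ?thesis by (simp add: R_const_def \<delta>_def c_def \<Lambda>_def)
  qed
  ultimately show ?thesis using that [OF k(1), of \<delta>] by (simp add: add.commute add.left_commute)
qed

lemma R_const_pos:
  assumes "3 \<le> N"
  shows "0 < R_const N n l"
proof -
  have "cos (2 * pi / real N) < cos 0"
    using assms by (intro cos_monotone_0_pi) (auto simp: field_simps)
  moreover have "1 \<le> cosh (real N ^ n * l / 2)" by (rule cosh_real_ge_1)
  ultimately show ?thesis
    unfolding R_const_def by (intro add_nonneg_pos) auto
qed

section \<open>The tube\<close>

lemma act_proj: "act A (proj z) = proj (A *v z)"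
proof -
  have "A *v rscale z l = rscale (A *v z) l" for l
    by (simp add: matrix_vector_mult_def rscale_def vec_eq_iff sum_distrib_right mult.assoc)
  then show ?thesis by (auto simp: act_def proj_def image_iff) metis+
qed

text \<open>All non-zero coordinates of a lift belong to entries of \<open>\<mu>\<close> of equal
  norm. A non-zero coordinate at \<open>p\<close> is then the only one, by strict dominance; if it
  vanishes, isotropy leaves just the coordinate at \<open>q\<close>.\<close>

lemma fixed_boundary_point:
  assumes "p \<noteq> q" and big: "\<And>i. i \<noteq> p \<Longrightarrow> norm (\<mu> i) < norm (\<mu> p)"
    and x: "x \<in> hyp_boundary p q" "act (dmat \<mu>) x = x"
  obtains a where "a \<in> {p, q}" "x = proj (axis a 1)"
proof -
  obtain z where z: "x = proj z" "z \<noteq> 0" "hform p q z z = 0"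
    using x(1) by (auto simp: hyp_boundary_def V_zero_def)
  have "dmat \<mu> *v z \<in> proj z" using x(2) z(1) in_proj [of "dmat \<mu> *v z"] by (simp add: act_proj)
  then obtain l where "dmat \<mu> *v z = rscale z l" by (auto simp: proj_def)
  then have e: "norm (\<mu> i) * norm (z $ i) = norm (z $ i) * norm l" for i
    by (metis dmat_vec norm_mult rscale_def vec_lambda_beta)
  have single: "\<exists>b\<in>{p, q}. x = proj (axis b 1)" if a: "a \<in> {p, q}" "\<And>i. i \<noteq> a \<Longrightarrow> z $ i = 0" for a
  proof -
    have "z = rscale (axis a 1) (z $ a)"
      using a(2) by (auto simp: rscale_def vec_eq_iff axis_def)
    moreover have "z $ a \<noteq> 0" using a(2) z(2) by (metis vec_eq_iff zero_index)
    ultimately have "x = proj (axis a 1)" using z(1) by (metis proj_rscale)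
    with a(1) show ?thesis by blast
  qed
  have "\<exists>b\<in>{p, q}. x = proj (axis b 1)"
  proof (cases "z $ p = 0")
    case False
    then have "norm l = norm (\<mu> p)" using e [of p] by simp
    then have "z $ i = 0" if "i \<noteq> p" for i using e [of i] big [OF that] by auto
    then show ?thesis by (intro single [of p]) auto
  next
    case True
    have "hnorm p q z = 0" using z(3) by (simp add: hnorm_def)
    then have "(\<Sum>i\<in>UNIV - {p, q}. (norm (z $ i))\<^sup>2) \<le> 0" using True by (simp add: hnorm_eq)
    then have "z $ i = 0" if "i \<noteq> q" for i
      using sum_sq_eq_0_imp [of "UNIV - {p, q}" "\<lambda>i. z $ i" i] that True by (cases "i = p") auto
    then show ?thesis by (intro single [of q]) auto
  qed
  then show ?thesis using that by blast
qed

lemma axis_of_dmat: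
  assumes "p \<noteq> q" and big: "\<And>i. i \<noteq> p \<Longrightarrow> norm (\<mu> i) < norm (\<mu> p)"
    and ax: "is_axis p q (dmat \<mu>) \<gamma>"
  shows "\<gamma> \<noteq> {}" and "y \<in> \<gamma> \<Longrightarrow> \<exists>s>0. y = proj (axis_vec p q s)"
proof -
  obtain x x' where xx: "x \<noteq> x'" "fixed_points p q (dmat \<mu>) = {x, x'}" "geodesic_joining p q x x' \<gamma>"
    and lox: "loxodromic p q (dmat \<mu>)"
    using ax by (auto simp: is_axis_def)
  obtain c where c: "geodesic_line p q c" "\<gamma> = range c" "proj_tendsto c x at_bot" "proj_tendsto c x' at_top"
    using xx(3) by (auto simp: geodesic_joining_def)
  show "\<gamma> \<noteq> {}" using c by simp
  assume "y \<in> \<gamma>"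
  have "z \<in> hyp_boundary p q" "act (dmat \<mu>) z = z" if "z \<in> {x, x'}" for z
    using lox that xx(2) by (auto simp: loxodromic_def fixed_points_def)
  then obtain a b where ab: "a \<in> {p, q}" "x = proj (axis a 1)" "b \<in> {p, q}" "x' = proj (axis b 1)"
    using fixed_boundary_point [where p = p and q = q and \<mu> = \<mu>, OF assms(1) big] by (metis insertI1 insertI2)
  \<comment> \<open>The geodesic may run in either direction, so \<open>a\<close> is not known to be
    \<open>p\<close>.\<close>
  have "b = sw p q a" using ab xx(1) by auto
  then show "\<exists>s>0. y = proj (axis_vec p q s)"
    using geodesic_subset_axis [OF assms(1) c(1) ab(1), of b y] ab c \<open>y \<in> \<gamma>\<close> by metis
qed

lemma tube_point:
  assumes "x \<in> tube p q r \<gamma>" "\<gamma> \<noteq> {}"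
  obtains y where "y \<in> \<gamma>" "bergman p q x y < r"
proof -
  have "\<exists>d\<in>bergman p q x ` \<gamma>. d < r"
    using assms by (intro cInf_lessD) (auto simp: tube_def)
  then show ?thesis using that by blast
qed

text \<open>Seen from the point of \<open>h *v v\<close>, the half distances \<open>a\<close> to the
  axis point at \<open>t\<close> and \<open>b\<close> to the image of the axis point at
  \<open>s\<close> add up to less than \<open>r\<close>. The double angle formula then matches the
  right side of \<open>Sp_entries_le\<close>.\<close>

lemma tube_meets_imp:
  assumes "p \<noteq> q" and h: "h \<in> carrier (Sp p q)"
    and \<gamma>: "\<gamma> \<noteq> {}" "\<And>y. y \<in> \<gamma> \<Longrightarrow> \<exists>s>0. y = proj (axis_vec p q s)"
    and x: "x \<in> tube p q r \<gamma>" "act h x \<in> tube p q r \<gamma>"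
  shows "norm (h $ p $ p) * norm (h $ q $ q) + norm (h $ p $ q) * norm (h $ q $ p) < cosh (2 * r)"
proof -
  obtain v where v: "hnorm p q v < 0" "x = proj v"
    using x(1) by (auto simp: tube_def hyp_space_def V_minus_def hnorm_def)
  obtain s where s: "0 < s" "bergman p q (proj v) (proj (axis_vec p q s)) < r"
    using tube_point [OF x(1) \<gamma>(1)] \<gamma>(2) v(2) by metis
  obtain t where t: "0 < t" "bergman p q (proj (h *v v)) (proj (axis_vec p q t)) < r"
    using tube_point [OF x(2) \<gamma>(1)] \<gamma>(2) v(2) by (metis act_proj)
  define a where "a = bergman p q (proj (h *v v)) (proj (axis_vec p q t)) / 2"
  define b where "b = bergman p q (proj v) (proj (axis_vec p q s)) / 2"
  have hs: "hnorm p q (axis_vec p q s) = - 2" "hnorm p q (axis_vec p q t) = - 2"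
    using hnorm_axis_vec [OF assms(1)] s t by auto
  have hv: "hnorm p q (h *v z) = hnorm p q z" "hform p q (h *v z) (h *v z') = hform p q z z'" for z z'
    using h by (simp_all add: hnorm_Sp) (simp add: Sp_def)
  have ab: "0 \<le> a" "0 \<le> b" "a + b < r"
    using bergman_proj(1) [of p q "h *v v" "axis_vec p q t"] bergman_proj(1) [of p q v "axis_vec p q s"]
      s t v by (simp_all add: hs hv a_def b_def)
  have "norm (hform p q (axis_vec p q t) (h *v axis_vec p q s)) \<le>
      cosh (a + b) * sqrt (hnorm p q (axis_vec p q t) * hnorm p q (h *v axis_vec p q s))"
  proof (rule hyp_triangle [where x = "h *v v"])
    show "norm (hform p q (axis_vec p q t) (h *v v)) =
        cosh a * sqrt (hnorm p q (axis_vec p q t) * hnorm p q (h *v v))"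
      using bergman_proj(2) [of p q "h *v v" "axis_vec p q t"] v
      by (simp add: hs hv a_def norm_hform_commute [of p q "axis_vec p q t"] mult.commute)
    show "norm (hform p q (h *v axis_vec p q s) (h *v v)) =
        cosh b * sqrt (hnorm p q (h *v axis_vec p q s) * hnorm p q (h *v v))"
      using bergman_proj(2) [of p q v "axis_vec p q s"] v
      by (simp add: hs hv b_def norm_hform_commute [of p q "axis_vec p q s"] mult.commute)
  qed (use ab v in \<open>simp_all add: hs hv\<close>)
  then have "norm (hform p q (axis_vec p q t) (h *v axis_vec p q s)) \<le> 2 * cosh (a + b)"
    by (simp add: hs hv)
  then have "(norm (hform p q (axis_vec p q t) (h *v axis_vec p q s)))\<^sup>2 \<le> (2 * cosh (a + b))\<^sup>2"
    by (rule power_mono) simp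
  then have "(norm (hform p q (axis_vec p q t) (h *v axis_vec p q s)))\<^sup>2 / 2 - 1 \<le> cosh (2 * (a + b))"
    unfolding cosh_double_cosh by (simp add: power_mult_distrib)
  also have "\<dots> < cosh (2 * r)"
    using ab by (intro cosh_real_strict_mono) auto
  finally show ?thesis
    using Sp_entries_le [OF assms(1) h s(1) t(1)] by linarith
qed

theorem theorem1p5:
  fixes p q :: "'m::finite" and n N :: nat
    and G :: "(quat ^ 'm ^ 'm) set" and g :: "quat ^ 'm ^ 'm"
    and \<gamma> :: "(quat ^ 'm) set set" and lam :: "'m \<Rightarrow> quat" and l r :: real
  assumes "n \<ge> 1" and "CARD('m) = n + 1" and "p \<noteq> q"
    and "N \<ge> 35"
    and "subgroup G (Sp p q)" and "discrete G" and "torsion_free (Sp p q) G"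
    and "\<not> elementary p q G"
    and "g \<in> G" and "loxodromic p q g" and "is_axis p q g \<gamma>"
    and "primitive_in (Sp p q) G g"
    and "g = lox_diag p q lam"
    and "\<And>i. i \<notin> {p, q} \<Longrightarrow> norm (lam i) = 1" and "norm (lam p) > 1"
    and "l = 2 * ln (norm (lam p))"
    and "R_const N n l < sqrt 3 - 1"
    and "r > 0" and "cosh (2 * r) = 2 * (1 - R_const N n l) / (R_const N n l)\<^sup>2"
  shows "precisely_invariant (tube p q r \<gamma>) (generate (Sp p q) {g}) G"
proof -
  define \<mu> where "\<mu> i = (if i = q then inverse (qcnj (lam p)) else lam i)" for i
  have g: "g = dmat \<mu>"
    unfolding assms(13) lox_diag_def dmat_def \<mu>_def by (simp add: vec_eq_iff)
  interpret torsion_free_lox p q G \<mu>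
    by (intro torsion_free_lox.intro discrete_lox.intro torsion_free_lox_axioms.intro)
      (use assms(3,5-7,9,14,15) g in \<open>auto simp: \<mu>_def norm_inverse divide_inverse\<close>)
  have less: "norm (\<mu> i) < norm (\<mu> p)" if "i \<noteq> p" for i
    using norm_le_1 [OF that] norm_p by simp
  note axis = axis_of_dmat [where \<mu> = \<mu>, OF pq less assms(11) [unfolded g]]
  obtain k :: nat and \<delta> where k: "0 < k" "0 \<le> \<delta>"
    and close: "\<And>i. i \<notin> {p, q} \<Longrightarrow> norm (lam i ^ k - 1) \<le> \<delta>"
    and R: "2 * \<delta> + norm (lam p ^ k - 1) + norm (inverse (qcnj (lam p)) ^ k - 1) \<le> R_const N n l"
    using lox_power_close [OF assms(3,2), of N lam] assms(4,14-16) by auto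
  have "h \<in> generate (Sp p q) {g}" if h: "h \<in> G" and meet: "act h ` tube p q r \<gamma> \<inter> tube p q r \<gamma> \<noteq> {}" for h
  proof -
    obtain x where x: "x \<in> tube p q r \<gamma>" "act h x \<in> tube p q r \<gamma>" using meet by blast
    have "norm (h $ p $ p) * norm (h $ q $ q) + norm (h $ p $ q) * norm (h $ q $ p) <
        2 * (1 - R_const N n l) / (R_const N n l)\<^sup>2"
      using tube_meets_imp [OF pq G_Sp [OF h] axis x] assms(19) by simp
    moreover have "dmat (\<lambda>i. \<mu> i ^ k) \<in> G"
      using stab_axis_power(1) [OF dmat_in, of k] by (simp add: dmat_pow) (simp add: stab_axis_def dmat_def)
    moreover have "1 < norm (\<mu> p ^ k)" "norm (\<mu> q ^ k) = 1 / norm (\<mu> p ^ k)"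
      using norm_p k(1) by (simp_all add: norm_power norm_q power_divide one_less_power)
    moreover have "norm (\<mu> i ^ k) = 1" if "i \<notin> {p, q}" for i
      using norm_other [OF that] by (simp add: norm_power)
    moreover have "norm (\<mu> i ^ k - 1) \<le> \<delta>" if "i \<notin> {p, q}" for i
      using close [OF that] that by (simp add: \<mu>_def)
    moreover have "2 * \<delta> + norm (\<mu> p ^ k - 1) + norm (\<mu> q ^ k - 1) \<le> R_const N n l"
      using R pq by (simp add: \<mu>_def)
    moreover have "0 < R_const N n l" using assms(4) by (intro R_const_pos) simp
    \<comment> \<open>The inequality is applied to the \<open>k\<close>-th power of
      \<open>g\<close>, whereas the balancing inside it uses \<open>dmat \<mu>\<close>, which is
      \<open>g\<close> itself.\<close>
    ultimately have "stab_axis h p"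
      using k(2) by (intro jorgensen [OF h, where \<kappa> = "\<lambda>i. \<mu> i ^ k" and \<delta> = \<delta> and M = "R_const N n l"])
    then show ?thesis
      using stab_axis_generate [OF _ h] assms(12) unfolding g by blast
  qed
  then show ?thesis unfolding precisely_invariant_def by blast
qed

end
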